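(* Let $I=[0,1]$ and let $\phi\colon F*\mathbb{Z}\to \mathrm{Diff}_+^1(I)$ be a homomorphism. Suppose that for every injective homomorphism $\iota\colon F\hookrightarrow F*\mathbb{Z}$ and for every connected component $J$ of $\operatorname{supp}\phi\iota(F)$, the action of $F$ on $J$ given by $g\mapsto \phi(\iota(g))|_J$ is either non-faithful or semi-conjugate to the standard piecewise linear action of $F$ on $[0,1]$. Then $\phi$ is not injective.
   Context: Thompson's group $F$ is the group of piecewise linear homeomorphisms of $[0,1]$ whose breakpoints are dyadic rationals and all of whose slopes are powers of $2$; its standard action is this action on $[0,1]$. For a group $G$ acting on $I$, $\operatorname{supp} g=I\setminus \mathrm{Fix}(g)$ and $\operatorname{supp} G=\bigcup_{g\in G}\operatorname{supp} g$. A semi-conjugacy between two actions on intervals is a monotone, surjective, continuous map between the (closed) intervals which intertwines the two actions. *)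

theory Defs
  imports "HOL-Analysis.Analysis" "HOL-Algebra.Elementary_Groups"
begin

text \<open>Homeomorphisms are represented as functions real => real that are the
identity outside [0,1]; the group law is composition.\<close>

definition dyadic :: "real \<Rightarrow> bool" where
  "dyadic x \<longleftrightarrow> (\<exists>(m::int) (k::nat). x = real_of_int m / 2 ^ k)"

definition thompsonF_elem :: "(real \<Rightarrow> real) \<Rightarrow> bool" where
  "thompsonF_elem f \<longleftrightarrow>
     (\<forall>x. x \<notin> {0..1} \<longrightarrow> f x = x) \<and> f 0 = 0 \<and> f 1 = 1 \<and>
     (\<exists>(n::nat) (a::nat \<Rightarrow> real) (s::nat \<Rightarrow> int).
        a 0 = 0 \<and> a n = 1 \<and> (\<forall>i\<le>n. dyadic (a i)) \<and>
        (\<forall>i<n. a i < a (Suc i)) \<and>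
        (\<forall>i<n. \<forall>x\<in>{a i..a (Suc i)}. f x = f (a i) + (2::real) powi (s i) * (x - a i)))"

definition thompsonF :: "(real \<Rightarrow> real) monoid" where
  "thompsonF = \<lparr>carrier = {f. thompsonF_elem f}, monoid.mult = (\<circ>), one = id\<rparr>"

definition diff1_plus :: "(real \<Rightarrow> real) \<Rightarrow> bool" where
  "diff1_plus f \<longleftrightarrow>
     (\<forall>x. x \<notin> {0..1} \<longrightarrow> f x = x) \<and> bij_betw f {0..1} {0..1} \<and>
     (\<exists>f'. continuous_on {0..1} f' \<and>
        (\<forall>x\<in>{0..1}. (f has_real_derivative f' x) (at x within {0..1}) \<and> f' x > 0))"

definition Diff1_plus_I :: "(real \<Rightarrow> real) monoid" where
  "Diff1_plus_I = \<lparr>carrier = {f. diff1_plus f}, monoid.mult = (\<circ>), one = id\<rparr>"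

definition fp_reduced :: "('a, 'c) monoid_scheme \<Rightarrow> ('b, 'd) monoid_scheme \<Rightarrow> ('a + 'b) list \<Rightarrow> bool" where
  "fp_reduced G H w \<longleftrightarrow>
     (\<forall>x\<in>set w. case x of Inl a \<Rightarrow> a \<in> carrier G \<and> a \<noteq> \<one>\<^bsub>G\<^esub>
                         | Inr b \<Rightarrow> b \<in> carrier H \<and> b \<noteq> \<one>\<^bsub>H\<^esub>) \<and>
     (\<forall>i. Suc i < length w \<longrightarrow> isl (w ! i) \<noteq> isl (w ! Suc i))"

fun fp_push :: "('a, 'c) monoid_scheme \<Rightarrow> ('b, 'd) monoid_scheme \<Rightarrow> ('a + 'b) \<Rightarrow> ('a + 'b) list \<Rightarrow> ('a + 'b) list" where
  "fp_push G H x [] = [x]"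
| "fp_push G H (Inl a) (Inl b # w) =
     (if a \<otimes>\<^bsub>G\<^esub> b = \<one>\<^bsub>G\<^esub> then w else Inl (a \<otimes>\<^bsub>G\<^esub> b) # w)"
| "fp_push G H (Inr a) (Inr b # w) =
     (if a \<otimes>\<^bsub>H\<^esub> b = \<one>\<^bsub>H\<^esub> then w else Inr (a \<otimes>\<^bsub>H\<^esub> b) # w)"
| "fp_push G H (Inl a) (Inr b # w) = Inl a # Inr b # w"
| "fp_push G H (Inr a) (Inl b # w) = Inr a # Inl b # w"

definition free_product :: "('a, 'c) monoid_scheme \<Rightarrow> ('b, 'd) monoid_scheme \<Rightarrow> ('a + 'b) list monoid" where
  "free_product G H = \<lparr>carrier = {w. fp_reduced G H w},
                        monoid.mult = (\<lambda>xs ys. foldr (fp_push G H) xs ys),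
                        one = []\<rparr>"

definition supp_action :: "('a, 'c) monoid_scheme \<Rightarrow> ('a \<Rightarrow> real \<Rightarrow> real) \<Rightarrow> real set" where
  "supp_action G \<rho> = (\<Union>g\<in>carrier G. {x\<in>{0..1}. \<rho> g x \<noteq> x})"

definition faithful_on :: "('a, 'c) monoid_scheme \<Rightarrow> ('a \<Rightarrow> real \<Rightarrow> real) \<Rightarrow> real set \<Rightarrow> bool" where
  "faithful_on G \<rho> J \<longleftrightarrow> inj_on (\<lambda>g. restrict (\<rho> g) J) (carrier G)"

definition semiconj_standard :: "((real \<Rightarrow> real) \<Rightarrow> real \<Rightarrow> real) \<Rightarrow> real set \<Rightarrow> bool" where
  "semiconj_standard \<rho> J \<longleftrightarrow>
     (\<exists>h :: real \<Rightarrow> real.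
        (mono_on (closure J) h \<or> antimono_on (closure J) h) \<and>
        h ` closure J = {0..1} \<and> continuous_on (closure J) h \<and>
        (\<forall>g\<in>carrier thompsonF. \<forall>x\<in>closure J. h (\<rho> g x) = g (h x)))"

end

theory Submission
  imports Defs
begin

text \<open>Suppose \<open>\<phi>\<close> is injective. In the standard action there are \<open>f, g \<in> F\<close> and points
  \<open>f y < s = g s < y < t = f t < g y\<close>; by the mean value theorem this configuration, lifted to a
  component \<open>J\<close> on which the action is semi-conjugate to the standard one, makes one of the two
  derivatives at least \<open>2\<close> somewhere in \<open>J\<close>. Derivatives are close to \<open>1\<close> on short components, so only
  finitely many components are faithful, and on all others suitable commutators act trivially because
  they lie in every nontrivial normal subgroup of \<open>F\<close>.

  Apply this to the copy \<open>A\<close> of \<open>F\<close> supported in \<open>[1/4, 3/4]\<close>. An endpoint of a faithful component of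
  \<open>A\<close> cannot be fixed by all of \<open>F\<close>: near such a point the semi-conjugacy takes values outside
  \<open>[1/4, 3/4]\<close>, and the ends of its fibres would be fixed points of \<open>A\<close> inside the component. Hence some
  nontrivial \<open>u \<in> F\<close> has its support inside finitely many compact intervals of the set moved by
  \<open>F * \<int>\<close>. If \<open>w\<close> moves the support of \<open>u\<close> in one component off itself, the commutator of \<open>u\<close> and
  \<open>w u w\<inverse>\<close> is trivial there; choosing \<open>w\<close> with suitable first and last letters keeps this commutator
  nontrivial in \<open>F * \<int>\<close>. Removing all components in this way contradicts injectivity.\<close>

section \<open>Groups of homeomorphisms of the line\<close>

text \<open>A strictly increasing bijection of the line is a homeomorphism, so monotonicity together
  with two-sided inverses encodes orientation-preserving homeomorphisms purely in terms of
  order.\<close>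

definition homeo_group :: "(real \<Rightarrow> real) set \<Rightarrow> bool" where
  "homeo_group \<Gamma> \<longleftrightarrow> id \<in> \<Gamma> \<and> (\<forall>f\<in>\<Gamma>. \<forall>g\<in>\<Gamma>. f \<circ> g \<in> \<Gamma>) \<and>
     (\<forall>f\<in>\<Gamma>. strict_mono f \<and> (\<exists>f'\<in>\<Gamma>. f \<circ> f' = id \<and> f' \<circ> f = id))"

definition moved :: "(real \<Rightarrow> real) set \<Rightarrow> real set" where
  "moved \<Gamma> = {x. \<exists>f\<in>\<Gamma>. f x \<noteq> x}"

lemma homeo_groupD:
  assumes "homeo_group \<Gamma>"
  shows "id \<in> \<Gamma>" "\<And>f g. f \<in> \<Gamma> \<Longrightarrow> g \<in> \<Gamma> \<Longrightarrow> f \<circ> g \<in> \<Gamma>" "\<And>f. f \<in> \<Gamma> \<Longrightarrow> strict_mono f"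
  using assms by (auto simp: homeo_group_def)

lemma homeo_group_inverse:
  assumes "homeo_group \<Gamma>" "f \<in> \<Gamma>"
  obtains f' where "f' \<in> \<Gamma>" "\<And>x. f (f' x) = x" "\<And>x. f' (f x) = x"
  using assms by (metis homeo_group_def comp_apply id_apply)

lemma moved_up:
  assumes "homeo_group \<Gamma>" "x \<in> moved \<Gamma>"
  obtains f where "f \<in> \<Gamma>" "x < f x"
proof -
  obtain f where f: "f \<in> \<Gamma>" "f x \<noteq> x" using assms by (auto simp: moved_def)
  obtain f' where f': "f' \<in> \<Gamma>" "\<And>x. f (f' x) = x" "\<And>x. f' (f x) = x"
    using homeo_group_inverse assms(1) f(1) by metis
  show thesis
  proof (cases "x < f x")
    case False
    then have "f x < x" using f by auto
    then have "x < f' x"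
      using strict_monoD[OF homeo_groupD(3)[OF assms(1) f'(1)]] f' by metis
    then show thesis using that f' by blast
  qed (use that f in blast)
qed

text \<open>If \<open>x < y < f x\<close>, monotonicity gives \<open>f z > y > z\<close> for every
  \<open>z\<close> between the preimage of \<open>y\<close> and \<open>y\<close>; this interval is a
  neighbourhood of \<open>x\<close>.\<close>

lemma open_moved:
  assumes "homeo_group \<Gamma>"
  shows "open (moved \<Gamma>)"
proof (subst open_subopen, rule ballI)
  fix x assume "x \<in> moved \<Gamma>"
  then obtain f where f: "f \<in> \<Gamma>" "x < f x" using moved_up assms by metis
  obtain f' where f': "f' \<in> \<Gamma>" "\<And>x. f (f' x) = x" "\<And>x. f' (f x) = x"
    using homeo_group_inverse assms(1) f(1) by metis
  obtain y where y: "x < y" "y < f x" using dense f(2) by blast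
  have m: "strict_mono f" "strict_mono f'" using assms f f' homeo_groupD by blast+
  have "f' y < x" using strict_monoD[OF m(2) y(2)] f' by simp
  moreover have "{f' y<..<y} \<subseteq> moved \<Gamma>"
  proof
    fix z assume z: "z \<in> {f' y<..<y}"
    then have "f (f' y) < f z" using strict_monoD[OF m(1)] by auto
    then have "f z \<noteq> z" using f' z by auto
    then show "z \<in> moved \<Gamma>" using f by (auto simp: moved_def)
  qed
  ultimately show "\<exists>T. open T \<and> x \<in> T \<and> T \<subseteq> moved \<Gamma>"
    using y by (intro exI[of _ "{f' y<..<y}"]) auto
qed

text \<open>If the orbit of \<open>c\<close> stayed below \<open>d\<close>, its supremum would lie
  in \<open>{c..d}\<close> and be moved up by some \<open>f\<close>. Orbit points just below the
  supremum would then be carried beyond it.\<close>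

lemma push_beyond:
  assumes G: "homeo_group \<Gamma>" and S: "{c..d} \<subseteq> moved \<Gamma>"
  obtains f where "f \<in> \<Gamma>" "d < f c"
proof (rule ccontr)
  assume "\<not> thesis"
  with that have le: "f c \<le> d" if "f \<in> \<Gamma>" for f using that not_le by blast
  define X where "X = (\<lambda>f. f c) ` \<Gamma>"
  have bdd: "bdd_above X" using le by (auto simp: X_def intro!: bdd_aboveI[of _ d])
  have cX: "c \<in> X" using imageI[OF homeo_groupD(1)[OF G], of "\<lambda>f. f c"] by (simp add: X_def)
  have "c \<le> Sup X" using cX bdd by (rule cSup_upper)
  moreover have "Sup X \<le> d" using cX le by (intro cSup_least) (auto simp: X_def)
  ultimately have "Sup X \<in> moved \<Gamma>" using S by auto
  then obtain f where f: "f \<in> \<Gamma>" "Sup X < f (Sup X)" using moved_up G by metis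
  obtain f' where f': "f' \<in> \<Gamma>" "\<And>x. f (f' x) = x" "\<And>x. f' (f x) = x"
    using homeo_group_inverse G f(1) by metis
  have "f' (Sup X) < Sup X"
    using strict_monoD[OF homeo_groupD(3)[OF G f'(1)] f(2)] f' by simp
  then obtain g where g: "g \<in> \<Gamma>" "f' (Sup X) < g c"
    using less_cSupD[of X "f' (Sup X)"] cX by (auto simp: X_def)
  then have "Sup X < f (g c)"
    using strict_monoD[OF homeo_groupD(3)[OF G f(1)] g(2)] f' by simp
  moreover have "f (g c) \<in> X"
    using imageI[OF homeo_groupD(2)[OF G f(1) g(1)], of "\<lambda>f. f c"] by (simp add: X_def)
  ultimately show False using cSup_upper[OF _ bdd] by force
qed

text \<open>A moved endpoint could be adjoined to the component without losing connectedness,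
  against maximality. So both endpoints are global fixed points, which is what makes components
  invariant.\<close>

lemma component_interval:
  assumes G: "homeo_group \<Gamma>" and J: "J \<in> components (moved \<Gamma>)" and B: "moved \<Gamma> \<subseteq> {0..1}"
  obtains p q where "p < q" "J = {p<..<q}" "p \<notin> moved \<Gamma>" "q \<notin> moved \<Gamma>" "0 \<le> p" "q \<le> 1"
proof -
  have opn: "open J" using open_components open_moved[OF G] J by blast
  have conn: "connected J" and ne: "J \<noteq> {}" and sub: "J \<subseteq> moved \<Gamma>"
    using J in_components_connected in_components_nonempty in_components_subset by blast+
  have bnd: "bdd_below J" "bdd_above J"
    using sub B by (auto intro!: bdd_belowI[of _ 0] bdd_aboveI[of _ 1])
  define p q where "p = Inf J" and "q = Sup J"
  have pJ: "p < x" if xJ: "x \<in> J" for x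
  proof -
    obtain e where "e > 0" "ball x e \<subseteq> J" using openE[OF opn xJ] by metis
    moreover have "x - e/2 \<in> ball x e" using \<open>e > 0\<close> by (simp add: dist_real_def)
    ultimately have "x - e/2 \<in> J" by blast
    then have "p \<le> x - e/2" unfolding p_def using bnd by (intro cInf_lower)
    then show ?thesis using \<open>e > 0\<close> by simp
  qed
  have qJ: "x < q" if xJ: "x \<in> J" for x
  proof -
    obtain e where "e > 0" "ball x e \<subseteq> J" using openE[OF opn xJ] by metis
    moreover have "x + e/2 \<in> ball x e" using \<open>e > 0\<close> by (simp add: dist_real_def)
    ultimately have "x + e/2 \<in> J" by blast
    then have "x + e/2 \<le> q" unfolding q_def using bnd by (intro cSup_upper)
    then show ?thesis using \<open>e > 0\<close> by simp
  qed
  have eq: "J = {p<..<q}"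
  proof
    show "J \<subseteq> {p<..<q}" using pJ qJ by auto
    show "{p<..<q} \<subseteq> J"
    proof
      fix x assume x: "x \<in> {p<..<q}"
      obtain a where "a \<in> J" "a < x" using x cInf_lessD[OF ne] by (auto simp: p_def)
      moreover obtain b where "b \<in> J" "x < b" using x less_cSupD[OF ne] by (auto simp: q_def)
      ultimately show "x \<in> J" using conn connectedD_interval by (metis less_imp_le)
    qed
  qed
  have pq: "p < q" using ne eq by force
  have "p \<notin> moved \<Gamma>"
  proof
    assume "p \<in> moved \<Gamma>"
    then have "{p..<q} \<subseteq> moved \<Gamma>" using sub eq by (auto simp: less_le subset_iff)
    moreover have "J \<inter> {p..<q} \<noteq> {}" using eq pq dense[of p q] by auto
    ultimately have "{p..<q} \<subseteq> J" using components_maximal[OF J connected_Ico] by blast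
    then show False using eq pq by auto
  qed
  moreover have "q \<notin> moved \<Gamma>"
  proof
    assume "q \<in> moved \<Gamma>"
    then have "{p<..q} \<subseteq> moved \<Gamma>" using sub eq by (auto simp: less_le subset_iff)
    moreover have "J \<inter> {p<..q} \<noteq> {}" using eq pq dense[of p q] by auto
    ultimately have "{p<..q} \<subseteq> J" using components_maximal[OF J connected_Ioc] by blast
    then show False using eq pq by auto
  qed
  moreover have "0 \<le> p" unfolding p_def using ne sub B by (intro cInf_greatest) auto
  moreover have "q \<le> 1" unfolding q_def using ne sub B by (intro cSup_least) auto
  ultimately show thesis using that pq eq by blast
qed

lemma component_invariant:
  assumes G: "homeo_group \<Gamma>" and J: "J \<in> components (moved \<Gamma>)" and B: "moved \<Gamma> \<subseteq> {0..1}"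
    and f: "f \<in> \<Gamma>"
  shows "f x \<in> J \<longleftrightarrow> x \<in> J"
proof -
  obtain p q where pq: "J = {p<..<q}" "p \<notin> moved \<Gamma>" "q \<notin> moved \<Gamma>"
    using component_interval[OF G J B] by metis
  have "f p = p" "f q = q" using pq f by (auto simp: moved_def)
  then show ?thesis
    using pq strict_mono_less[OF homeo_groupD(3)[OF G f]] by (metis greaterThanLessThan_iff)
qed

text \<open>An increasing map that preserves a compact set together with its inverse fixes the
  minimum and the maximum. The points \<open>a\<close> and \<open>b\<close> are chosen before
  \<open>f\<close>, so one pair serves a whole group; \<open>T\<close> will be a fibre of a
  semi-conjugacy.\<close>

lemma fiber_ends:
  fixes T :: "real set"
  assumes "compact T" "x \<in> T"
  shows "\<exists>a\<in>T. \<exists>b\<in>T. a \<le> x \<and> x \<le> b \<and>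
    (\<forall>f f'. strict_mono f \<longrightarrow> (\<forall>y. f (f' y) = y) \<longrightarrow> f ` T \<subseteq> T \<longrightarrow> f' ` T \<subseteq> T \<longrightarrow> f a = a \<and> f b = b)"
proof -
  obtain a where a: "a \<in> T" "\<And>t. t \<in> T \<Longrightarrow> a \<le> t"
    using compact_attains_inf[OF assms(1)] assms(2) by (metis empty_iff)
  obtain b where b: "b \<in> T" "\<And>t. t \<in> T \<Longrightarrow> t \<le> b"
    using compact_attains_sup[OF assms(1)] assms(2) by (metis empty_iff)
  have "\<forall>f f'. strict_mono f \<longrightarrow> (\<forall>y. f (f' y) = y) \<longrightarrow> f ` T \<subseteq> T \<longrightarrow> f' ` T \<subseteq> T \<longrightarrow>
      f a = a \<and> f b = b"
  proof (intro allI impI)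
    fix f f' assume f: "strict_mono f" "\<forall>y. f (f' y) = y" "f ` T \<subseteq> T" "f' ` T \<subseteq> T"
    have "f a \<le> f (f' a)" using strict_mono_less_eq[OF f(1)] a f(4) by auto
    moreover have "f (f' b) \<le> f b" using strict_mono_less_eq[OF f(1)] b f(4) by auto
    moreover have "a \<le> f a" "f b \<le> b" using a b f(3) by auto
    ultimately show "f a = a \<and> f b = b" using f(2) by auto
  qed
  then show ?thesis
    using a(2)[OF assms(2)] b(2)[OF assms(2)] by (intro bexI[OF _ a(1)] bexI[OF _ b(1)] conjI)
qed

text \<open>By injectivity, a point moved by one map is sent to a point that this map moves again,
  hence to one that the other map fixes. The invariant set \<open>E\<close> allows the supports to
  be disjoint on only part of the line.\<close>

lemma commute_if_disjoint_supports:
  assumes "inj U" "inj V" "\<And>y. y \<in> E \<Longrightarrow> U y = y \<or> V y = y"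
    "\<And>y. U y \<in> E \<longleftrightarrow> y \<in> E" "\<And>y. V y \<in> E \<longleftrightarrow> y \<in> E" "y \<in> E"
  shows "U (V y) = V (U y)"
  using assms by (metis injD)

section \<open>Words in a free product acting on the line\<close>

definition fp_letter :: "('a, 'c) monoid_scheme \<Rightarrow> ('b, 'd) monoid_scheme \<Rightarrow> 'a + 'b \<Rightarrow> bool" where
  "fp_letter G H x \<longleftrightarrow> (case x of Inl a \<Rightarrow> a \<in> carrier G \<and> a \<noteq> \<one>\<^bsub>G\<^esub>
                                | Inr b \<Rightarrow> b \<in> carrier H \<and> b \<noteq> \<one>\<^bsub>H\<^esub>)"

definition fp_inv :: "('a, 'c) monoid_scheme \<Rightarrow> ('b, 'd) monoid_scheme \<Rightarrow> ('a + 'b) list \<Rightarrow> ('a + 'b) list" where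
  "fp_inv G H w = rev (map (map_sum (m_inv G) (m_inv H)) w)"

lemma fp_letter_simps [simp]:
  "fp_letter G H (Inl a) \<longleftrightarrow> a \<in> carrier G \<and> a \<noteq> \<one>\<^bsub>G\<^esub>"
  "fp_letter G H (Inr b) \<longleftrightarrow> b \<in> carrier H \<and> b \<noteq> \<one>\<^bsub>H\<^esub>"
  by (simp_all add: fp_letter_def)

lemma fp_reduced_Nil [simp]: "fp_reduced G H []"
  by (simp add: fp_reduced_def)

lemma fp_reduced_Cons:
  "fp_reduced G H (x # w) \<longleftrightarrow>
     fp_letter G H x \<and> fp_reduced G H w \<and> (w = [] \<or> isl x \<noteq> isl (hd w))"
proof -
  have "(\<forall>i. Suc i < length (x # w) \<longrightarrow> isl ((x # w) ! i) \<noteq> isl ((x # w) ! Suc i)) \<longleftrightarrow>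
        (w = [] \<or> isl x \<noteq> isl (hd w)) \<and>
        (\<forall>i. Suc i < length w \<longrightarrow> isl (w ! i) \<noteq> isl (w ! Suc i))" (is "?L \<longleftrightarrow> ?R")
  proof
    assume L: ?L
    have "w = [] \<or> isl x \<noteq> isl (hd w)" using L[rule_format, of 0] by (auto simp: hd_conv_nth)
    moreover have "\<forall>i. Suc i < length w \<longrightarrow> isl (w ! i) \<noteq> isl (w ! Suc i)"
    proof (intro allI impI)
      fix i assume "Suc i < length w"
      then show "isl (w ! i) \<noteq> isl (w ! Suc i)" using L[rule_format, of "Suc i"] by simp
    qed
    ultimately show ?R by blast
  next
    assume R: ?R
    show ?L
    proof (intro allI impI)
      fix i assume "Suc i < length (x # w)"
      then show "isl ((x # w) ! i) \<noteq> isl ((x # w) ! Suc i)"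
        using R by (cases i) (auto simp: hd_conv_nth)
    qed
  qed
  then show ?thesis unfolding fp_reduced_def fp_letter_def by auto
qed

lemma fp_reduced_append:
  "fp_reduced G H (xs @ ys) \<longleftrightarrow>
     fp_reduced G H xs \<and> fp_reduced G H ys \<and> (xs = [] \<or> ys = [] \<or> isl (last xs) \<noteq> isl (hd ys))"
  by (induction xs) (auto simp: fp_reduced_Cons hd_append)

lemma fp_push_reduced:
  assumes "group G" "group H" "fp_letter G H x" "fp_reduced G H w"
  shows "fp_reduced G H (fp_push G H x w)"
proof (cases w)
  case Nil
  then show ?thesis using assms by (simp add: fp_reduced_Cons)
next
  case (Cons y ys)
  then show ?thesis
    using assms monoid.m_closed[OF group.is_monoid[OF assms(1)]] monoid.m_closed[OF group.is_monoid[OF assms(2)]]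
    by (cases x; cases y; cases ys) (auto simp: fp_reduced_Cons)
qed

lemma fp_foldr_reduced:
  assumes "group G" "group H" "fp_reduced G H xs" "fp_reduced G H ys"
  shows "fp_reduced G H (foldr (fp_push G H) xs ys)"
  using assms(3) by (induction xs) (auto simp: assms fp_reduced_Cons fp_push_reduced)

lemma fp_push_Cons:
  assumes "w = [] \<or> isl x \<noteq> isl (hd w)"
  shows "fp_push G H x w = x # w"
  using assms by (cases w; cases x; cases "hd w") auto

text \<open>Where a concatenation is reduced, pushing letters never multiplies or cancels. Through
  \<open>\<phi>_append\<close> this evaluates the explicit words built below.\<close>

lemma fp_foldr_append:
  assumes "fp_reduced G H (xs @ ys)"
  shows "foldr (fp_push G H) xs ys = xs @ ys"
  using assms by (induction xs) (auto simp: fp_reduced_Cons fp_push_Cons)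

lemma isl_map_sum [simp]: "isl (map_sum f g x) = isl x"
  by (cases x) auto

lemma fp_letter_inv:
  assumes "group G" "group H" "fp_letter G H x"
  shows "fp_letter G H (map_sum (m_inv G) (m_inv H) x)"
  using assms by (cases x) (auto simp: group.inv_eq_1_iff)

lemma fp_reduced_inv:
  assumes "group G" "group H" "fp_reduced G H w"
  shows "fp_reduced G H (fp_inv G H w)"
  using assms(3)
  by (induction w)
     (auto simp: fp_inv_def fp_reduced_Cons fp_reduced_append fp_letter_inv[OF assms(1,2)]
           last_rev hd_map)

lemma fp_inv_mult:
  assumes "group G" "group H" "fp_reduced G H w"
  shows "foldr (fp_push G H) (fp_inv G H w) w = []"
  using assms(3)
proof (induction w)
  case (Cons x w)
  have "fp_push G H (map_sum (m_inv G) (m_inv H) x) (x # w) = w"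
    using Cons.prems assms by (cases x) (auto simp: fp_reduced_Cons group.l_inv)
  then show ?case using Cons by (simp add: fp_inv_def fp_reduced_Cons)
qed (simp add: fp_inv_def)

lemma fp_inv_ends:
  assumes "w \<noteq> []"
  shows "fp_inv G H w \<noteq> []" "isl (hd (fp_inv G H w)) = isl (last w)"
    "isl (last (fp_inv G H w)) = isl (hd w)"
  using assms by (auto simp: fp_inv_def hd_rev last_rev last_map hd_map)

section \<open>Actions of a free product on the unit interval\<close>

locale word_action =
  fixes G :: "('a, 'c) monoid_scheme" and H :: "('b, 'd) monoid_scheme"
    and \<phi> :: "('a + 'b) list \<Rightarrow> real \<Rightarrow> real"
  assumes grp: "group G" "group H"
    and mult: "\<And>x y. fp_reduced G H x \<Longrightarrow> fp_reduced G H y \<Longrightarrow>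
                 \<phi> (foldr (fp_push G H) x y) = \<phi> x \<circ> \<phi> y"
    and smono: "\<And>x. fp_reduced G H x \<Longrightarrow> strict_mono (\<phi> x)"
    and ident: "\<And>x z. fp_reduced G H x \<Longrightarrow> z \<notin> {0..1} \<Longrightarrow> \<phi> x z = z"
begin

definition \<Gamma> where "\<Gamma> = \<phi> ` {w. fp_reduced G H w}"

lemma \<phi>_in: "fp_reduced G H w \<Longrightarrow> \<phi> w \<in> \<Gamma>"
  by (auto simp: \<Gamma>_def)

lemma \<phi>_Nil: "\<phi> [] z = z"
  using mult[of "[]" "[]"] smono[of "[]"] by (simp add: fun_eq_iff) (metis strict_mono_eq)

lemma \<phi>_append: "fp_reduced G H (xs @ ys) \<Longrightarrow> \<phi> (xs @ ys) z = \<phi> xs (\<phi> ys z)"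
  using mult[of xs ys] fp_foldr_append[of G H xs ys] by (simp add: fp_reduced_append)

lemma \<phi>_inv:
  assumes "fp_reduced G H w"
  shows "\<phi> (fp_inv G H w) (\<phi> w z) = z" "\<phi> w (\<phi> (fp_inv G H w) z) = z"
proof -
  have r: "fp_reduced G H (fp_inv G H w)" using fp_reduced_inv grp assms by blast
  have *: "\<phi> (fp_inv G H w) (\<phi> w z) = z" for z
    using mult[OF r assms] fp_inv_mult[OF grp assms] \<phi>_Nil by (metis comp_apply)
  then show "\<phi> (fp_inv G H w) (\<phi> w z) = z" by blast
  show "\<phi> w (\<phi> (fp_inv G H w) z) = z"
    using *[of "\<phi> (fp_inv G H w) z"] strict_mono_eq[OF smono[OF r]] by blast
qed

lemma homeo_group_\<Gamma>: "homeo_group \<Gamma>"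
proof -
  have "id \<in> \<Gamma>" using \<phi>_in[of "[]"] \<phi>_Nil by (metis eq_id_iff fp_reduced_Nil)
  moreover have "f \<circ> g \<in> \<Gamma>" if fg: "f \<in> \<Gamma>" "g \<in> \<Gamma>" for f g
  proof -
    obtain x y where "f = \<phi> x" "g = \<phi> y" "fp_reduced G H x" "fp_reduced G H y"
      using fg by (auto simp: \<Gamma>_def)
    then show ?thesis using mult \<phi>_in fp_foldr_reduced[OF grp] by metis
  qed
  moreover have "strict_mono f \<and> (\<exists>f'\<in>\<Gamma>. f \<circ> f' = id \<and> f' \<circ> f = id)" if f: "f \<in> \<Gamma>" for f
  proof -
    obtain x where x: "f = \<phi> x" "fp_reduced G H x" using f by (auto simp: \<Gamma>_def)
    then show ?thesis
      using smono \<phi>_inv[OF x(2)] \<phi>_in[OF fp_reduced_inv[OF grp x(2)]]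
      by (intro conjI bexI[of _ "\<phi> (fp_inv G H x)"]) (auto simp: comp_def id_def)
  qed
  ultimately show ?thesis by (auto simp: homeo_group_def)
qed

lemma moved_\<Gamma>_subset: "moved \<Gamma> \<subseteq> {0..1}"
  unfolding moved_def \<Gamma>_def using ident by blast

lemma invariant: "J \<in> components (moved \<Gamma>) \<Longrightarrow> fp_reduced G H w \<Longrightarrow> \<phi> w x \<in> J \<longleftrightarrow> x \<in> J"
  using component_invariant[OF homeo_group_\<Gamma> _ moved_\<Gamma>_subset \<phi>_in] by blast

text \<open>End letters from \<open>H\<close> let \<open>w\<close> stand between words with end
  letters from \<open>G\<close> without cancellation. A word with a wrong end is repaired by adding
  \<open>Inr t\<close> there.\<close>

lemma pushing_word:
  assumes J: "J \<in> components (moved \<Gamma>)" and cd: "c \<in> J" "d \<in> J" "c \<le> d"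
    and t: "t \<in> carrier H" "t \<noteq> \<one>\<^bsub>H\<^esub>"
  obtains w where "fp_reduced G H w" "w \<noteq> []" "\<not> isl (hd w)" "\<not> isl (last w)" "d < \<phi> w c"
proof -
  define T T' where "T = \<phi> [Inr t]" and "T' = \<phi> (fp_inv G H [Inr t])"
  have tr: "fp_reduced G H [Inr t]" using t by (simp add: fp_reduced_Cons)
  have TT': "T (T' x) = x" for x using \<phi>_inv[OF tr] by (simp add: T_def T'_def)
  have mT: "strict_mono T" using smono tr by (simp add: T_def)
  \<comment> \<open>A word carrying \<open>c1\<close> beyond \<open>d1\<close> carries both
    \<open>c\<close> and \<open>T c\<close> there, and the result stays beyond \<open>d\<close>
    after a further application of \<open>T\<close>. So adding \<open>Inr t\<close> at either end
    keeps the estimate.\<close>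
  define c1 d1 where "c1 = min c (T c)" and "d1 = max d (T' d)"
  have "T c \<in> J" "T' d \<in> J"
    using cd invariant[OF J tr] invariant[OF J fp_reduced_inv[OF grp tr]]
    by (auto simp: T_def T'_def)
  then have "c1 \<in> J" "d1 \<in> J" using cd by (auto simp: c1_def d1_def min_def max_def)
  moreover obtain p q where "J = {p<..<q}"
    using component_interval[OF homeo_group_\<Gamma> J moved_\<Gamma>_subset] by metis
  ultimately have "{c1..d1} \<subseteq> J" by auto
  then have "{c1..d1} \<subseteq> moved \<Gamma>" using in_components_subset[OF J] by blast
  then obtain g where "g \<in> \<Gamma>" "d1 < g c1" using push_beyond homeo_group_\<Gamma> by metis
  then obtain w where w: "fp_reduced G H w" "d1 < \<phi> w c1" by (auto simp: \<Gamma>_def)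
  have mw: "\<phi> w x \<le> \<phi> w y" if "x \<le> y" for x y
    using that strict_mono_less_eq[OF smono[OF w(1)]] by blast
  have w1: "d1 < \<phi> w c" "d1 < \<phi> w (T c)"
    using w(2) mw[of c1 c] mw[of c1 "T c"] by (auto simp: c1_def)
  have w2: "d < y" "d < T y" if "d1 < y" for y
  proof -
    show "d < y" using that by (simp add: d1_def)
    have "T' d < y" using that by (simp add: d1_def)
    then show "d < T y" using strict_monoD[OF mT, of "T' d" y] TT' by simp
  qed
  have ne: "w \<noteq> []"
  proof
    assume "w = []"
    then have "d1 < c" using w1 \<phi>_Nil by simp
    then show False using cd by (simp add: d1_def)
  qed
  show thesis
  proof (cases "isl (hd w)"; cases "isl (last w)")
    assume h: "isl (hd w)" "isl (last w)"
    then have r: "fp_reduced G H ([Inr t] @ (w @ [Inr t]))" "fp_reduced G H (w @ [Inr t])"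
      using w(1) ne tr t by (auto simp: fp_reduced_append fp_reduced_Cons)
    have "\<phi> ([Inr t] @ (w @ [Inr t])) c = T (\<phi> w (T c))"
      using \<phi>_append[OF r(1)] \<phi>_append[OF r(2)] by (simp add: T_def)
    then show thesis using that[OF r(1)] w1 w2 by simp
  next
    assume h: "isl (hd w)" "\<not> isl (last w)"
    then have r: "fp_reduced G H ([Inr t] @ w)"
      using w(1) ne tr t by (auto simp: fp_reduced_append fp_reduced_Cons)
    have "\<phi> ([Inr t] @ w) c = T (\<phi> w c)"
      using \<phi>_append[OF r] by (simp add: T_def)
    then show thesis using that[OF r] w1 w2 h ne by simp
  next
    assume h: "\<not> isl (hd w)" "isl (last w)"
    then have r: "fp_reduced G H (w @ [Inr t])"
      using w(1) ne tr t by (auto simp: fp_reduced_append fp_reduced_Cons)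
    have "\<phi> (w @ [Inr t]) c = \<phi> w (T c)"
      using \<phi>_append[OF r] by (simp add: T_def)
    then show thesis using that[OF r] w1 w2 h ne by simp
  next
    assume h: "\<not> isl (hd w)" "\<not> isl (last w)"
    then show thesis using that[OF w(1) ne] w1 w2 by simp
  qed
qed

text \<open>Induction on the finite set \<open>\<J>\<close>: the commutator of \<open>u\<close> with
  a suitable conjugate clears one component and, after a conjugation, is again a nonempty word with
  both end letters in \<open>G\<close>. When no component is left, a nonempty reduced word acts
  trivially, against injectivity.\<close>

lemma no_compactly_supported_word:
  assumes ab: "a \<in> carrier G" "b \<in> carrier G" "a \<noteq> \<one>\<^bsub>G\<^esub>" "b \<noteq> \<one>\<^bsub>G\<^esub>" "a \<noteq> b"
    and t: "t \<in> carrier H" "t \<noteq> \<one>\<^bsub>H\<^esub>"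
    and inj: "inj_on \<phi> {w. fp_reduced G H w}"
    and fin: "finite \<J>" and comp: "\<J> \<subseteq> components (moved \<Gamma>)"
    and u: "fp_reduced G H u" "u \<noteq> []" "isl (hd u)" "isl (last u)"
    and supp: "\<And>x. \<phi> u x \<noteq> x \<Longrightarrow> x \<in> \<Union>\<J>"
    and bnd: "\<And>J. J \<in> \<J> \<Longrightarrow> \<exists>c\<in>J. \<exists>d\<in>J. \<forall>x\<in>J. \<phi> u x \<noteq> x \<longrightarrow> c \<le> x \<and> x \<le> d"
  shows False
  using fin comp u supp bnd
proof (induction \<J> arbitrary: u rule: finite_induct)
  case empty
  then have "\<phi> u = \<phi> []" using \<phi>_Nil by (auto simp: fun_eq_iff)
  then show False using inj_onD[OF inj, of u "[]"] empty by auto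
next
  case (insert J \<J>)
  have J: "J \<in> components (moved \<Gamma>)" using insert.prems by blast
  have C\<J>: "\<J> \<subseteq> components (moved \<Gamma>)" using insert.prems by blast
  obtain c d0 where cd0: "c \<in> J" "d0 \<in> J" "\<And>x. x \<in> J \<Longrightarrow> \<phi> u x \<noteq> x \<Longrightarrow> c \<le> x \<and> x \<le> d0"
    using insert.prems(7)[of J] by auto
  \<comment> \<open>The maximum secures \<open>c \<le> d\<close> even when \<open>u\<close> fixes
    all of \<open>J\<close>.\<close>
  define d where "d = max c d0"
  have cd: "c \<in> J" "d \<in> J" "c \<le> d" "\<And>x. x \<in> J \<Longrightarrow> \<phi> u x \<noteq> x \<Longrightarrow> c \<le> x \<and> x \<le> d"
    using cd0 by (auto simp: d_def max_def dest: order_trans)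
  obtain w where w: "fp_reduced G H w" "w \<noteq> []" "\<not> isl (hd w)" "\<not> isl (last w)" "d < \<phi> w c"
    using pushing_word[OF J cd(1-3) t] by metis
  note ur = insert.prems(2) and une = insert.prems(3) and uh = insert.prems(4) and ul = insert.prems(5)
  define u' w' where "u' = fp_inv G H u" and "w' = fp_inv G H w"
  have u'r: "fp_reduced G H u'" "u' \<noteq> []" "isl (hd u')" "isl (last u')"
    using fp_reduced_inv[OF grp ur] fp_inv_ends[OF une, of G H] uh ul by (simp_all add: u'_def)
  have w'r: "fp_reduced G H w'" "w' \<noteq> []" "\<not> isl (hd w')" "\<not> isl (last w')"
    using fp_reduced_inv[OF grp w(1)] fp_inv_ends[OF w(2), of G H] w(3,4) by (simp_all add: w'_def)
  \<comment> \<open>The commutator of \<open>u\<close> with its conjugate by \<open>w\<close>. At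
    every junction a letter of \<open>G\<close> meets a letter of \<open>H\<close>, so the
    concatenation is already reduced.\<close>
  define k where "k = u @ w @ u @ w' @ u' @ w @ u' @ w'"
  note red = fp_reduced_append ur une uh ul u'r w w'r hd_append
  have kr: "fp_reduced G H k" "k \<noteq> []" "isl (hd k)" "\<not> isl (last k)"
    by (simp_all add: k_def red)
  have \<phi>k: "\<phi> k z = \<phi> u (\<phi> w (\<phi> u (\<phi> w' (\<phi> u' (\<phi> w (\<phi> u' (\<phi> w' z)))))))" for z
    unfolding k_def by (subst \<phi>_append, simp add: red)+ simp
  obtain x k0 where x: "k = Inl x # k0" using kr by (cases k; cases "hd k") auto
  have xG: "x \<in> carrier G" using kr x by (simp add: fp_reduced_Cons)
  \<comment> \<open>If both products were trivial, \<open>a\<close> and \<open>b\<close> would both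
    be the inverse of \<open>x\<close>. The choice of \<open>\<alpha>\<close> prevents the
    conjugation from cancelling the first letter of \<open>k\<close>.\<close>
  have "a \<otimes>\<^bsub>G\<^esub> x \<noteq> \<one>\<^bsub>G\<^esub> \<or> b \<otimes>\<^bsub>G\<^esub> x \<noteq> \<one>\<^bsub>G\<^esub>"
    using ab xG grp by (metis group.inv_equality group.inv_inv)
  then obtain \<alpha> where \<alpha>: "\<alpha> \<in> carrier G" "\<alpha> \<noteq> \<one>\<^bsub>G\<^esub>" "\<alpha> \<otimes>\<^bsub>G\<^esub> x \<noteq> \<one>\<^bsub>G\<^esub>" using ab by blast
  have k0: "fp_reduced G H k0" "k0 \<noteq> []" "\<not> isl (hd k0)" "\<not> isl (last k0)"
    using kr x by (auto simp: fp_reduced_Cons split: if_splits)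
  define \<alpha>' where "\<alpha>' = m_inv G \<alpha>"
  have \<alpha>': "\<alpha>' \<in> carrier G" "\<alpha>' \<noteq> \<one>\<^bsub>G\<^esub>"
    using \<alpha> grp by (auto simp: \<alpha>'_def group.inv_eq_1_iff)
  have \<alpha>r: "fp_reduced G H [Inl \<alpha>]" using \<alpha> by (simp add: fp_reduced_Cons)
  \<comment> \<open>\<open>k\<close> ends with a letter of \<open>H\<close>; conjugating by \<open>\<alpha>\<close> makes it end with a letter of \<open>G\<close> again\<close>
  define v where "v = (Inl (\<alpha> \<otimes>\<^bsub>G\<^esub> x) # k0) @ [Inl \<alpha>']"
  have vr1: "fp_reduced G H (Inl (\<alpha> \<otimes>\<^bsub>G\<^esub> x) # k0)"
    using k0 \<alpha> xG grp by (auto simp: fp_reduced_Cons group.is_monoid monoid.m_closed)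
  have vr: "fp_reduced G H v" "v \<noteq> []" "isl (hd v)" "isl (last v)"
    using vr1 k0 \<alpha>' by (auto simp: v_def fp_reduced_append fp_reduced_Cons)
  define A A' where "A = \<phi> [Inl \<alpha>]" and "A' = \<phi> [Inl \<alpha>']"
  have A': "A' = \<phi> (fp_inv G H [Inl \<alpha>])" by (simp add: A'_def \<alpha>'_def fp_inv_def)
  have AA': "A (A' z) = z" "A' (A z) = z" for z
    using \<phi>_inv[OF \<alpha>r] by (simp_all add: A_def A')
  have mA: "strict_mono A" using smono \<alpha>r by (simp add: A_def)
  have "foldr (fp_push G H) [Inl \<alpha>] k = Inl (\<alpha> \<otimes>\<^bsub>G\<^esub> x) # k0" using x \<alpha> by simp
  then have "\<phi> (Inl (\<alpha> \<otimes>\<^bsub>G\<^esub> x) # k0) z = A (\<phi> k z)" for z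
    using mult[OF \<alpha>r kr(1)] by (simp add: A_def)
  then have \<phi>v: "\<phi> v z = A (\<phi> k (A' z))" for z
    using \<phi>_append[OF vr(1)[unfolded v_def], of z] by (simp add: v_def A'_def)
  \<comment> \<open>Off the components still to be treated, \<open>u\<close> moves only points of
    \<open>J\<close>; there the supports of \<open>U\<close> and \<open>V\<close> are
    disjoint.\<close>
  define E where "E = - \<Union>\<J>"
  have Einv: "\<phi> y z \<in> E \<longleftrightarrow> z \<in> E" if "fp_reduced G H y" for y z
    using invariant[OF _ that] C\<J> by (auto simp: E_def)
  define U U' V V' where "U = \<phi> u" and "U' = \<phi> u'" and "V = (\<lambda>z. \<phi> w (\<phi> u (\<phi> w' z)))"
    and "V' = (\<lambda>z. \<phi> w (\<phi> u' (\<phi> w' z)))"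
  have UU': "U (U' z) = z" "U' (U z) = z" for z
    using \<phi>_inv[OF ur] by (simp_all add: U_def U'_def u'_def)
  have WW': "\<phi> w (\<phi> w' z) = z" "\<phi> w' (\<phi> w z) = z" for z
    using \<phi>_inv[OF w(1)] by (simp_all add: w'_def)
  have VV': "V (V' z) = z" "V' (V z) = z" for z
    using UU' WW' by (simp_all add: V_def V'_def U_def U'_def)
  have K: "\<phi> k z = U (V (U' (V' z)))" for z by (simp add: \<phi>k U_def U'_def V_def V'_def)
  have Vsupp: "V z \<noteq> z \<Longrightarrow> U (\<phi> w' z) \<noteq> \<phi> w' z" for z
    using WW' by (auto simp: V_def U_def)
  have inv4: "U z \<in> E \<longleftrightarrow> z \<in> E" "V z \<in> E \<longleftrightarrow> z \<in> E" "U' z \<in> E \<longleftrightarrow> z \<in> E" "V' z \<in> E \<longleftrightarrow> z \<in> E" for z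
    using Einv ur w(1) u'r(1) w'r(1) by (simp_all add: U_def U'_def V_def V'_def)
  have disj: "U y = y \<or> V y = y" if "y \<in> E" for y
  proof (rule ccontr)
    assume n: "\<not> (U y = y \<or> V y = y)"
    then have yJ: "y \<in> J" using insert.prems(6)[of y] that by (auto simp: U_def E_def)
    then have "y \<le> d" using cd(4)[of y] n by (simp add: U_def)
    moreover have "\<phi> w' y \<in> J" using invariant[OF J w'r(1)] yJ by blast
    then have "c \<le> \<phi> w' y" using cd(4)[of "\<phi> w' y"] Vsupp[of y] n by (simp add: U_def)
    then have "\<phi> w c \<le> y" using strict_mono_less_eq[OF smono[OF w(1)]] WW' by metis
    ultimately show False using w(5) by simp
  qed
  have inj_UV: "inj U" "inj V"
    using UU' VV' by (metis inj_on_inverseI)+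
  have Kid: "\<phi> k z = z" if "z \<in> E" for z
  proof -
    have "U' (V' z) \<in> E" using inv4 that by blast
    then have "U (V (U' (V' z))) = V (U (U' (V' z)))"
      using commute_if_disjoint_supports[OF inj_UV disj inv4(1,2)] by blast
    then show ?thesis using K UU' VV' by simp
  qed
  have vsupp: "x \<in> \<Union>\<J>" if "\<phi> v x \<noteq> x" for x
  proof -
    have "A' x \<notin> E" using that Kid[of "A' x"] AA' \<phi>v by auto
    then show ?thesis
      using Einv[of "[Inl \<alpha>']" x] \<alpha>' by (auto simp: E_def A'_def fp_reduced_Cons)
  qed
  have vbnd: "\<exists>c\<in>J'. \<exists>d\<in>J'. \<forall>x\<in>J'. \<phi> v x \<noteq> x \<longrightarrow> c \<le> x \<and> x \<le> d" if J': "J' \<in> \<J>" for J'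
  proof -
    have CJ': "J' \<in> components (moved \<Gamma>)" using J' C\<J> by blast
    obtain c d where cd: "c \<in> J'" "d \<in> J'" "\<And>x. x \<in> J' \<Longrightarrow> \<phi> u x \<noteq> x \<Longrightarrow> c \<le> x \<and> x \<le> d"
      using insert.prems(7)[of J'] J' by auto
    \<comment> \<open>In \<open>J'\<close> the support of \<open>V\<close> lies between the images
      of \<open>c\<close> and \<open>d\<close> under \<open>w\<close>, so \<open>{c2..d2}\<close>
      covers the supports of both \<open>U\<close> and \<open>V\<close>. Conjugation by
      \<open>\<alpha>\<close> then transports these bounds by \<open>A\<close>.\<close>
    define c2 d2 where "c2 = min c (\<phi> w c)" and "d2 = max d (\<phi> w d)"
    have in2: "c2 \<in> J'" "d2 \<in> J'"
      using cd invariant[OF CJ' w(1)] by (auto simp: c2_def d2_def min_def max_def)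
    have Ak: "A c2 \<in> J'" "A d2 \<in> J'" using in2 invariant[OF CJ' \<alpha>r] by (auto simp: A_def)
    have "A c2 \<le> x \<and> x \<le> A d2" if xJ: "x \<in> J'" and nx: "\<phi> v x \<noteq> x" for x
    proof -
      define y where "y = A' x"
      have yJ: "y \<in> J'"
        using invariant[OF CJ', of "[Inl \<alpha>']"] \<alpha>' xJ by (simp add: y_def A'_def fp_reduced_Cons)
      have "U y \<noteq> y \<or> V y \<noteq> y"
      proof (rule ccontr)
        assume "\<not> (U y \<noteq> y \<or> V y \<noteq> y)"
        then have "U' y = y" "V' y = y" "U y = y" "V y = y" using UU' VV' by metis+
        then have "\<phi> k y = y" using K by simp
        then show False using nx \<phi>v AA' by (simp add: y_def)
      qed
      then have "c2 \<le> y \<and> y \<le> d2"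
      proof
        assume "U y \<noteq> y"
        then show ?thesis using cd(3)[OF yJ] by (auto simp: U_def c2_def d2_def)
      next
        assume "V y \<noteq> y"
        then have "c \<le> \<phi> w' y \<and> \<phi> w' y \<le> d"
          using cd(3)[of "\<phi> w' y"] Vsupp invariant[OF CJ' w'r(1)] yJ by (simp add: U_def)
        then have "\<phi> w c \<le> y \<and> y \<le> \<phi> w d"
          using strict_mono_less_eq[OF smono[OF w(1)]] WW' by metis
        then show ?thesis by (auto simp: c2_def d2_def)
      qed
      then have "A c2 \<le> A y \<and> A y \<le> A d2" using strict_mono_less_eq[OF mA] by blast
      then show ?thesis using AA' by (simp add: y_def)
    qed
    then show ?thesis using Ak by blast
  qed
  show False using insert.IH[OF C\<J> vr vsupp vbnd] by blast
qed

end

section \<open>Thompson's group as dyadic piecewise linear maps\<close>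

text \<open>\<open>dyadic_pl K f\<close>: \<open>f\<close> maps each standard dyadic interval of level \<open>K\<close> affinely onto a standard
  dyadic interval of some level \<open>L\<close> (a tree-pair diagram with a uniform source tree). This form is
  stable under refinement, so compositions and inverses need no bookkeeping of breakpoints.\<close>

definition dyadic_pl :: "nat \<Rightarrow> (real \<Rightarrow> real) \<Rightarrow> bool" where
  "dyadic_pl K f \<longleftrightarrow> (\<forall>i::int. \<exists>(j::int) (L::nat). \<forall>x\<in>{0..1::real}. f ((i + x) / 2 ^ K) = (j + x) / 2 ^ L)"

text \<open>Halving a source interval halves its image, so \<open>M\<close> subdivisions raise the
  target level by \<open>M\<close>. The bound \<open>M \<le> L\<close> is what composition uses: the
  images are then fine enough for the second map.\<close>

lemma dyadic_pl_refine:
  fixes i :: int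
  assumes "dyadic_pl K f"
  shows "\<exists>(j::int) (L::nat). M \<le> L \<and> (\<forall>x\<in>{0..1::real}. f ((i + x) / 2 ^ (K + M)) = (j + x) / 2 ^ L)"
proof (induction M arbitrary: i)
  case 0
  then show ?case using assms by (force simp: dyadic_pl_def)
next
  case (Suc M)
  obtain j :: int and L where L: "M \<le> L"
    and jL: "\<And>x::real. x \<in> {0..1::real} \<Longrightarrow> f ((real_of_int (i div 2) + x) / 2 ^ (K + M)) = (j + x) / 2 ^ L"
    using Suc.IH[of "i div 2"] by blast
  define r where "r = i mod 2"
  have i: "i = 2 * (i div 2) + r" and r: "r = 0 \<or> r = 1" by (auto simp: r_def)
  have "f ((i + x) / 2 ^ (K + Suc M)) = ((2 * j + r :: int) + x) / 2 ^ Suc L" if x: "x \<in> {0..1::real}" for x :: real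
  proof -
    have "(real_of_int i + x) / 2 ^ (K + Suc M) = (real_of_int (i div 2) + (r + x) / 2) / 2 ^ (K + M)"
      by (subst i) (simp add: field_simps)
    moreover have "(r + x) / 2 \<in> {0..1::real}" using r x by auto
    ultimately have "f ((i + x) / 2 ^ (K + Suc M)) = (j + (r + x) / 2) / 2 ^ L" using jL by simp
    then show ?thesis by (simp add: field_simps)
  qed
  then show ?case using L by (intro exI[of _ "2 * j + r"] exI[of _ "Suc L"]) auto
qed

lemma dyadic_pl_mono: "dyadic_pl K f \<Longrightarrow> K \<le> K' \<Longrightarrow> dyadic_pl K' f"
  using dyadic_pl_refine[of K f "K' - K"] unfolding dyadic_pl_def by (metis le_add_diff_inverse)

lemma dyadic_pl_comp:
  assumes f: "dyadic_pl K f" and g: "dyadic_pl M g"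
  shows "dyadic_pl (K + M) (g \<circ> f)"
  unfolding dyadic_pl_def
proof
  fix i :: int
  obtain j :: int and L where L: "M \<le> L"
    and j: "\<forall>x\<in>{0..1::real}. f ((i + x) / 2 ^ (K + M)) = (j + x) / 2 ^ L"
    using dyadic_pl_refine[OF f, of M i] by blast
  have "dyadic_pl L g" using dyadic_pl_mono g L by blast
  then obtain j' :: int and L' where "\<forall>x\<in>{0..1::real}. g ((j + x) / 2 ^ L) = (j' + x) / 2 ^ L'"
    unfolding dyadic_pl_def by blast
  then show "\<exists>(j::int) (L::nat). \<forall>x\<in>{0..1::real}. (g \<circ> f) ((i + x) / 2 ^ (K + M)) = (j + x) / 2 ^ L"
    using j by (intro exI[of _ j'] exI[of _ L']) auto
qed

lemma dyadic_pl_step: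
  assumes "dyadic_pl K f"
  obtains j :: int and L :: nat where
    "\<And>y::real. i / 2 ^ K \<le> y \<Longrightarrow> y \<le> (real_of_int i + 1) / 2 ^ K \<Longrightarrow> f y = (j + (y * 2 ^ K - real_of_int i)) / 2 ^ L"
proof -
  obtain j :: int and L where jL: "\<forall>x\<in>{0..1::real}. f ((i + x) / 2 ^ K) = (j + x) / 2 ^ L"
    using assms unfolding dyadic_pl_def by blast
  have "f y = (j + (y * 2 ^ K - i)) / 2 ^ L" if "i / 2 ^ K \<le> y" "y \<le> (real_of_int i + 1) / 2 ^ K" for y :: real
  proof -
    have "y * 2 ^ K - i \<in> {0..1::real}" using that by (auto simp: field_simps)
    then have "f ((i + (y * 2 ^ K - i)) / 2 ^ K) = (j + (y * 2 ^ K - i)) / 2 ^ L" using jL by blast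
    then show ?thesis by simp
  qed
  then show thesis using that by blast
qed

text \<open>The map is affine and increasing on each cell, and adjacent cells share a grid point, so
  the inequalities chain along the grid.\<close>

lemma dyadic_pl_strict_mono:
  assumes "dyadic_pl K f"
  shows "strict_mono f"
proof (rule strict_monoI)
  have piece: "f y < f z" if "i / 2 ^ K \<le> y" "y < z" "z \<le> (real_of_int i + 1) / 2 ^ K" for y z :: real and i :: int
  proof -
    obtain j :: int and L where "\<And>y::real. i / 2 ^ K \<le> y \<Longrightarrow> y \<le> (real_of_int i + 1) / 2 ^ K \<Longrightarrow>
        f y = (j + (y * 2 ^ K - real_of_int i)) / 2 ^ L"
      using dyadic_pl_step[OF assms] by metis
    then show ?thesis using that by (simp add: divide_strict_right_mono)
  qed
  have grid: "f (i / 2 ^ K) \<le> f (i' / 2 ^ K)" if "i \<le> i'" for i i' :: int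
    using that
  proof (induction rule: int_ge_induct)
    case (step i')
    have "f (i' / 2 ^ K) < f ((real_of_int i' + 1) / 2 ^ K)" by (rule piece[of i']) (auto simp: divide_strict_right_mono)
    then show ?case using step by (simp add: add.commute)
  qed simp
  fix y z :: real assume yz: "y < z"
  define i i' where "i = \<lfloor>y * 2 ^ K\<rfloor>" and "i' = \<lfloor>z * 2 ^ K\<rfloor>"
  have y: "i / 2 ^ K \<le> y" "y < (real_of_int i + 1) / 2 ^ K"
    by (auto simp: i_def divide_simps)
  have z: "i' / 2 ^ K \<le> z" "z < (real_of_int i' + 1) / 2 ^ K"
    by (auto simp: i'_def divide_simps)
  show "f y < f z"
  proof (cases "z \<le> (real_of_int i + 1) / 2 ^ K")
    case True
    then show ?thesis using piece y yz by blast
  next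
    case False
    then have "(real_of_int i + 1) / 2 ^ K < (real_of_int i' + 1) / 2 ^ K" using z by linarith
    then have "i + 1 \<le> i'" by (simp add: divide_less_cancel)
    have "f y < f ((real_of_int i + 1) / 2 ^ K)" using piece[of i y "(real_of_int i + 1) / 2 ^ K"] y by simp
    also have "\<dots> \<le> f (i' / 2 ^ K)" using grid[OF \<open>i + 1 \<le> i'\<close>] by simp
    also have "\<dots> \<le> f z" using piece[of i' "i' / 2 ^ K" z] z by (cases "z = i' / 2 ^ K") auto
    finally show ?thesis .
  qed
qed

text \<open>The unit interval is filled cell by cell: the image of each cell is an interval that
  starts where the preceding one ends.\<close>

lemma dyadic_pl_surj:
  assumes "dyadic_pl K f" "f 0 = 0" "f 1 = 1" "\<And>x::real. x \<notin> {0..1::real} \<Longrightarrow> f x = x"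
  shows "\<exists>x. f x = y"
proof (cases "y \<in> {0..1::real}")
  case True
  have "\<exists>x. f x = y" if "f 0 \<le> y" "y \<le> f (n / 2 ^ K)" for n :: nat
    using that
  proof (induction n)
    case (Suc n)
    show ?case
    proof (cases "y \<le> f (n / 2 ^ K)")
      case False
      obtain j :: int and L where jL: "\<forall>x\<in>{0..1::real}. f ((int n + x) / 2 ^ K) = (j + x) / 2 ^ L"
        using assms(1) unfolding dyadic_pl_def by blast
      have "f (n / 2 ^ K) = j / 2 ^ L" "f (real (Suc n) / 2 ^ K) = (j + 1) / 2 ^ L"
        using bspec[OF jL, of 0] bspec[OF jL, of 1] by (auto simp: add.commute)
      then have "j / 2 ^ L \<le> y" "y \<le> (j + 1) / 2 ^ L" using False Suc.prems by auto
      then have "y * 2 ^ L - j \<in> {0..1::real}"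
        by (auto simp: pos_divide_le_eq pos_le_divide_eq algebra_simps)
      then have "f ((int n + (y * 2 ^ L - j)) / 2 ^ K) = (j + (y * 2 ^ L - j)) / 2 ^ L"
        using jL by blast
      then show ?thesis by (metis add_diff_cancel_left' add.commute diff_add_cancel nonzero_mult_div_cancel_right power_not_zero zero_neq_numeral)
    qed (use Suc in auto)
  qed (intro exI[of _ 0], auto)
  from this[of "2 ^ K"] show ?thesis using True assms by simp
qed (use assms(4) in blast)

section \<open>Dyadic arithmetic and the passage from breakpoints to a uniform grid\<close>

lemma dyadic_common:
  fixes n :: nat
  assumes "\<forall>i\<le>n. dyadic (b i)"
  shows "\<exists>N::nat. \<forall>N'\<ge>N. \<forall>i\<le>n. \<exists>m::int. b i = m / 2 ^ N'"
  using assms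
proof (induction n)
  have one: "\<exists>m::int. x = m / 2 ^ N'" if "x = real_of_int m / 2 ^ k" "k \<le> N'" for x m k N'
  proof
    have "(2::real) ^ N' = 2 ^ k * 2 ^ (N' - k)" using that(2) by (simp flip: power_add)
    then show "x = real_of_int (m * 2 ^ (N' - k)) / 2 ^ N'" using that(1) by (simp add: field_simps)
  qed
  {
    case 0
    then obtain m :: int and k where "b 0 = m / 2 ^ k" by (auto simp: dyadic_def)
    then show ?case using one by (intro exI[of _ k]) blast
  next
    case (Suc n)
    then obtain N :: nat where N: "\<forall>N'\<ge>N. \<forall>i\<le>n. \<exists>m::int. b i = m / 2 ^ N'" by (metis le_SucI)
    obtain m :: int and k where mk: "b (Suc n) = m / 2 ^ k" using Suc.prems by (auto simp: dyadic_def)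
    have "\<exists>m::int. b i = m / 2 ^ N'" if "N' \<ge> max N k" "i \<le> Suc n" for i N'
      using that N one[OF mk, of N'] by (cases "i = Suc n") auto
    then show ?case by blast
  }
qed

lemma dyadic_simps:
  "dyadic 0" "dyadic x \<Longrightarrow> dyadic y \<Longrightarrow> dyadic (x + y)" "dyadic x \<Longrightarrow> dyadic (- x)"
  "dyadic x \<Longrightarrow> dyadic (2 powi s * x)"
proof -
  show "dyadic 0" unfolding dyadic_def by (intro exI[of _ 0]) simp
  show "dyadic (x + y)" if xy: "dyadic x" "dyadic y"
  proof -
    obtain m k m' k' where e: "x = real_of_int m / 2 ^ k" "y = real_of_int m' / 2 ^ k'"
      using xy unfolding dyadic_def by blast
    have "x + y = real_of_int (m * 2 ^ k' + m' * 2 ^ k) / 2 ^ (k + k')"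
      unfolding e by (simp add: field_simps power_add)
    then show ?thesis unfolding dyadic_def by blast
  qed
  show "dyadic (- x)" if x: "dyadic x"
  proof -
    obtain m k where "x = real_of_int m / 2 ^ k" using x unfolding dyadic_def by blast
    then have "- x = real_of_int (- m) / 2 ^ k" by simp
    then show ?thesis unfolding dyadic_def by blast
  qed
  show "dyadic (2 powi s * x)" if x: "dyadic x"
  proof -
    obtain m k where mk: "x = real_of_int m / 2 ^ k" using x unfolding dyadic_def by blast
    show ?thesis
    proof (cases "s \<ge> 0")
      case True
      then have "2 powi s * x = real_of_int (m * 2 ^ nat s) / 2 ^ k" using mk by (simp add: power_int_def)
      then show ?thesis unfolding dyadic_def by blast
    next
      case False
      then have "2 powi s * x = real_of_int m / 2 ^ (k + nat (- s))"
        using mk by (simp add: power_int_def field_simps power_add)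
      then show ?thesis unfolding dyadic_def by blast
    qed
  qed
qed

text \<open>\<open>N\<close> is a common denominator exponent for the breakpoints and their images,
  and \<open>B\<close> bounds the slope exponents. At level \<open>K = N + B\<close> no breakpoint
  is interior to a cell, and the image of each cell has level at least \<open>N\<close>, so its left
  end is a grid point of that level.\<close>

lemma thompsonF_elem_imp_dyadic_pl:
  assumes "thompsonF_elem f"
  shows "\<exists>K. dyadic_pl K f"
proof -
  obtain n :: nat and a :: "nat \<Rightarrow> real" and s :: "nat \<Rightarrow> int" where
    a: "a 0 = 0" "a n = 1" "\<forall>i\<le>n. dyadic (a i)" "\<forall>i<n. a i < a (Suc i)"
    and fa: "\<forall>i<n. \<forall>x\<in>{a i..a (Suc i)}. f x = f (a i) + (2::real) powi (s i) * (x - a i)"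
    using assms unfolding thompsonF_elem_def by blast
  have f: "\<And>x::real. x \<notin> {0..1::real} \<Longrightarrow> f x = x" "f 0 = 0" "f 1 = 1"
    using assms unfolding thompsonF_elem_def by blast+
  have "i \<le> n \<Longrightarrow> dyadic (f (a i))" for i
  proof (induction i)
    case 0
    then show ?case using a f dyadic_simps by simp
  next
    case (Suc i)
    have "f (a (Suc i)) = f (a i) + 2 powi (s i) * (a (Suc i) + - a i)"
      using fa[rule_format, of i "a (Suc i)"] a(4) Suc.prems by (simp add: less_imp_le)
    then show ?case using Suc a(3) dyadic_simps by (metis Suc_leD)
  qed
  then obtain N1 N2 where N1: "\<forall>N'\<ge>N1. \<forall>i\<le>n. \<exists>m::int. a i = m / 2 ^ N'"
    and N2: "\<forall>N'\<ge>N2. \<forall>i\<le>n. \<exists>m::int. f (a i) = m / 2 ^ N'"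
    using dyadic_common[of n a] dyadic_common[of n "\<lambda>i. f (a i)"] a(3) by blast
  define N where "N = max N1 N2"
  define B where "B = (\<Sum>i<n. nat \<bar>s i\<bar>)"
  have sB: "s l \<le> int B" if "l < n" for l
  proof -
    have "nat \<bar>s l\<bar> \<le> B" unfolding B_def using that by (intro member_le_sum) auto
    then show ?thesis by linarith
  qed
  define K where "K = N + B"
  have "dyadic_pl K f" unfolding dyadic_pl_def
  proof
    fix i :: int
    consider "i < 0" | "2 ^ K \<le> i" | "0 \<le> i" "i < 2 ^ K" by linarith
    then show "\<exists>(j::int) (L::nat). \<forall>x\<in>{0..1::real}. f ((i + x) / 2 ^ K) = (j + x) / 2 ^ L"
    proof cases
      case 1
      have "f ((i + x) / 2 ^ K) = (i + x) / 2 ^ K" if "x \<in> {0..1::real}" for x :: real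
      proof -
        have "(i + x) / 2 ^ K \<le> 0" using 1 that by (auto simp: divide_le_0_iff)
        then show ?thesis using f by (cases "(i + x) / 2 ^ K = 0") auto
      qed
      then show ?thesis by blast
    next
      case 2
      have "f ((i + x) / 2 ^ K) = (i + x) / 2 ^ K" if "x \<in> {0..1::real}" for x :: real
      proof -
        have "2 ^ K \<le> real_of_int i" using 2 by (metis of_int_le_iff of_int_numeral of_int_power)
        moreover have "0 \<le> x" using that by simp
        ultimately have "2 ^ K \<le> i + x" by linarith
        then have "(i + x) / 2 ^ K \<ge> 1" by (simp add: le_divide_eq)
        then show ?thesis using f by (cases "(i + x) / 2 ^ K = 1") auto
      qed
      then show ?thesis by blast
    next
      case 3
      define y where "y = i / 2 ^ K"
      have y0: "0 \<le> y" using 3 by (simp add: y_def)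
      have "real_of_int i < 2 ^ K" using 3 by (metis of_int_less_iff of_int_numeral of_int_power)
      then have y1: "y < 1" by (simp add: y_def)
      have "\<exists>l<k. a l \<le> y \<and> y < a (Suc l)" if "k \<le> n" "y < a k" for k
        using that
      proof (induction k)
        case (Suc k)
        then show ?case by (cases "y < a k") (auto simp: less_Suc_eq)
      qed (use a y0 in auto)
      then obtain l where l: "l < n" "a l \<le> y" "y < a (Suc l)" using a(2) y1 by (metis order_refl)
      obtain m1 m2 m3 :: int where m: "a (Suc l) = m1 / 2 ^ K" "a l = m2 / 2 ^ K" "f (a l) = m3 / 2 ^ N"
        using N1 N2 l(1) by (auto simp: N_def K_def) (metis Suc_leI less_imp_le max.cobounded1 max.cobounded2 trans_le_add1)
      have "i < m1" using l(3) m(1) by (simp add: y_def divide_less_cancel)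
      then have up: "(real_of_int i + 1) / 2 ^ K \<le> a (Suc l)" using m(1) by (simp add: divide_right_mono)
      \<comment> \<open>On this piece the slope is \<open>2 powi s l\<close>, so a cell of length
        \<open>1 / 2 ^ K\<close> has an image of length \<open>1 / 2 ^ L\<close>.\<close>
      define L where "L = nat (int K - s l)"
      have L: "int L = int K - s l" "N \<le> L" using sB[OF l(1)] by (auto simp: L_def K_def)
      have pL: "(2::real) powi (s l) = 2 ^ K / 2 ^ L"
      proof -
        have "s l = int K - int L" using L by simp
        then show ?thesis by (simp add: power_int_diff)
      qed
      have pN: "(2::real) ^ L = 2 ^ N * 2 ^ (L - N)" using L(2) by (simp flip: power_add)
      have "f ((i + x) / 2 ^ K) = ((m3 * 2 ^ (L - N) + i - m2 :: int) + x) / 2 ^ L" if x: "x \<in> {0..1::real}" for x :: real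
      proof -
        have "y \<le> (i + x) / 2 ^ K" "(i + x) / 2 ^ K \<le> (real_of_int i + 1) / 2 ^ K"
          using x by (auto simp: y_def divide_right_mono)
        then have "(i + x) / 2 ^ K \<in> {a l..a (Suc l)}" using l up by auto
        then have "f ((i + x) / 2 ^ K) = m3 / 2 ^ N + 2 ^ K / 2 ^ L * ((i + x) / 2 ^ K - m2 / 2 ^ K)"
          using fa l(1) pL m by metis
        also have "2 ^ K / 2 ^ L * ((i + x) / 2 ^ K - m2 / 2 ^ K) = (i + x - m2) / (2::real) ^ L"
          by (simp add: field_simps)
        also have "m3 / 2 ^ N = (m3 * 2 ^ (L - N)) / (2::real) ^ L" by (simp add: pN)
        finally show ?thesis by (simp add: add_divide_distrib diff_divide_distrib)
      qed
      then show ?thesis by blast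
    qed
  qed
  then show ?thesis by blast
qed

text \<open>The working description of the elements from here on. For the converse, the grid of
  level \<open>K\<close> supplies the breakpoints, and target level \<open>L i\<close> gives the
  slope exponent \<open>K - L i\<close>.\<close>

lemma thompsonF_elem_iff:
  "thompsonF_elem f \<longleftrightarrow> (\<forall>x. x \<notin> {0..1::real} \<longrightarrow> f x = x) \<and> f 0 = 0 \<and> f 1 = 1 \<and> (\<exists>K. dyadic_pl K f)"
proof
  assume "thompsonF_elem f"
  then show "(\<forall>x. x \<notin> {0..1::real} \<longrightarrow> f x = x) \<and> f 0 = 0 \<and> f 1 = 1 \<and> (\<exists>K. dyadic_pl K f)"
    using thompsonF_elem_imp_dyadic_pl by (simp add: thompsonF_elem_def)
next
  assume A: "(\<forall>x. x \<notin> {0..1::real} \<longrightarrow> f x = x) \<and> f 0 = 0 \<and> f 1 = 1 \<and> (\<exists>K. dyadic_pl K f)"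
  then obtain K where K: "dyadic_pl K f" by blast
  have "\<forall>i::nat. \<exists>(j::int) (L::nat). \<forall>y::real. real i / 2 ^ K \<le> y \<and> y \<le> (real i + 1) / 2 ^ K \<longrightarrow>
      f y = (j + (y * 2 ^ K - real i)) / 2 ^ L"
  proof
    fix i :: nat
    show "\<exists>(j::int) (L::nat). \<forall>y::real. real i / 2 ^ K \<le> y \<and> y \<le> (real i + 1) / 2 ^ K \<longrightarrow>
      f y = (j + (y * 2 ^ K - real i)) / 2 ^ L"
      using dyadic_pl_step[OF K, of "int i"] by (metis of_int_of_nat_eq)
  qed
  then obtain j :: "nat \<Rightarrow> int" and L :: "nat \<Rightarrow> nat" where
    jL: "\<And>i (y::real). real i / 2 ^ K \<le> y \<and> y \<le> (real i + 1) / 2 ^ K \<Longrightarrow> f y = (j i + (y * 2 ^ K - real i)) / 2 ^ L i"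
    by metis
  define a where "a i = real i / 2 ^ K" for i
  define s where "s i = int K - int (L i)" for i
  have "f x = f (a i) + 2 powi (s i) * (x - a i)" if "x \<in> {a i..a (Suc i)}" for i x
  proof -
    have e1: "f x = (j i + (x * 2 ^ K - real i)) / 2 ^ L i"
      using jL[of i x] that by (simp add: a_def add.commute)
    have e2: "f (a i) = j i / 2 ^ L i"
      using jL[of i "a i"] by (simp add: a_def divide_right_mono)
    have e3: "2 powi (s i) = (2::real) ^ K / 2 ^ L i" by (simp add: s_def power_int_diff)
    show ?thesis unfolding e1 e2 e3 by (simp add: a_def field_simps)
  qed
  moreover have "dyadic (a i)" for i unfolding dyadic_def a_def by (metis of_int_of_nat_eq)
  moreover have "a 0 = 0" "a (2 ^ K) = 1" "a i < a (Suc i)" for i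
    by (auto simp: a_def divide_strict_right_mono)
  ultimately show "thompsonF_elem f"
    using A unfolding thompsonF_elem_def by blast
qed

section \<open>Group structure of Thompson's group\<close>

lemma carrier_thompsonF: "f \<in> carrier thompsonF \<longleftrightarrow> thompsonF_elem f"
  by (simp add: thompsonF_def)

lemma thompsonF_strict_mono: "f \<in> carrier thompsonF \<Longrightarrow> strict_mono f"
  using dyadic_pl_strict_mono by (auto simp: carrier_thompsonF thompsonF_elem_iff)

lemma thompsonF_outside: "f \<in> carrier thompsonF \<Longrightarrow> x \<notin> {0<..<1} \<Longrightarrow> f x = x"
  by (cases "x = 0 \<or> x = 1") (auto simp: carrier_thompsonF thompsonF_elem_def)

lemma thompsonF_inside: "f \<in> carrier thompsonF \<Longrightarrow> f x \<in> {0<..<1} \<longleftrightarrow> x \<in> {0<..<1}"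
  using thompsonF_outside[of f 0] thompsonF_outside[of f 1] strict_mono_less[OF thompsonF_strict_mono]
  by (metis greaterThanLessThan_iff less_irrefl)

lemma thompsonF_bij: 
  assumes "f \<in> carrier thompsonF" 
  shows "bij f"
proof -
  have "inj f" using thompsonF_strict_mono[OF assms] strict_mono_eq by (metis injI)
  moreover have "\<exists>x. f x = y" for y :: real
    using assms dyadic_pl_surj unfolding carrier_thompsonF thompsonF_elem_iff by metis
  then have "surj f" by (metis surjI)
  ultimately show ?thesis by (simp add: bij_def)
qed

lemma id_in_thompsonF: "id \<in> carrier thompsonF"
proof -
  have "dyadic_pl 0 id" unfolding dyadic_pl_def by (intro allI, rule exI, rule exI[of _ 0]) auto
  then show ?thesis unfolding carrier_thompsonF thompsonF_elem_iff by auto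
qed

lemma comp_in_thompsonF:
  assumes "f \<in> carrier thompsonF" "g \<in> carrier thompsonF"
  shows "f \<circ> g \<in> carrier thompsonF"
proof -
  have "\<exists>K. dyadic_pl K (f \<circ> g)"
    using assms dyadic_pl_comp unfolding carrier_thompsonF thompsonF_elem_iff by blast
  then show ?thesis using assms unfolding carrier_thompsonF thompsonF_elem_iff by auto
qed

text \<open>Standard dyadic intervals are nested or have disjoint interiors. As \<open>M\<close> is
  at least every target level occurring in the unit interval, each cell of level \<open>M\<close>
  there lies in the image of a single cell of \<open>f\<close>, on which the inverse is
  affine.\<close>

lemma inverse_in_thompsonF:
  assumes f: "f \<in> carrier thompsonF" and g: "\<And>x. f (g x) = x" "\<And>x. g (f x) = x"
  shows "g \<in> carrier thompsonF"
proof -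
  obtain K where K: "dyadic_pl K f" using f unfolding carrier_thompsonF thompsonF_elem_iff by blast
  have gout: "g x = x" if "x \<notin> {0<..<1}" for x using thompsonF_outside[OF f that] g by metis
  have gin: "g x \<in> {0<..<1} \<longleftrightarrow> x \<in> {0<..<1}" for x using thompsonF_inside[OF f, of "g x"] g by simp
  obtain j :: "int \<Rightarrow> int" and L :: "int \<Rightarrow> nat" where
    jL: "\<And>i (x::real). x \<in> {0..1::real} \<Longrightarrow> f ((i + x) / 2 ^ K) = (j i + x) / 2 ^ L i"
    using K unfolding dyadic_pl_def by metis
  define M where "M = (\<Sum>i\<in>{0..<2 ^ K}. L i)"
  have LM: "L k \<le> M" if "k \<in> {0..<2 ^ K}" for k
    unfolding M_def using that by (intro member_le_sum) auto
  have "dyadic_pl M g" unfolding dyadic_pl_def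
  proof
    fix i :: int
    consider "i < 0" | "2 ^ M \<le> i" | "0 \<le> i" "i < 2 ^ M" by linarith
    then show "\<exists>(j::int) (L::nat). \<forall>x\<in>{0..1::real}. g ((i + x) / 2 ^ M) = (j + x) / 2 ^ L"
    proof cases
      case 1
      have "g ((i + x) / 2 ^ M) = (i + x) / 2 ^ M" if "x \<in> {0..1::real}" for x :: real
      proof -
        have "(i + x) / 2 ^ M \<le> 0" using 1 that by (auto simp: divide_le_0_iff)
        then show ?thesis using gout by auto
      qed
      then show ?thesis by blast
    next
      case 2
      have "g ((i + x) / 2 ^ M) = (i + x) / 2 ^ M" if "x \<in> {0..1::real}" for x :: real
      proof -
        have "2 ^ M \<le> real_of_int i" using 2 by (metis of_int_le_iff of_int_numeral of_int_power)
        moreover have "0 \<le> x" using that by simp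
        ultimately have "2 ^ M \<le> i + x" by linarith
        then have "(i + x) / 2 ^ M \<ge> 1" by (simp add: le_divide_eq)
        then show ?thesis using gout by auto
      qed
      then show ?thesis by blast
    next
      case 3
      \<comment> \<open>The midpoint is not an endpoint of any dyadic interval of level at most
        \<open>M\<close>, so \<open>g m\<close> selects the one cell whose image contains the whole
        \<open>i\<close>-th cell.\<close>
      define m where "m = (real_of_int i + 1/2) / 2 ^ M"
      have "real_of_int (i + 1) \<le> real_of_int (2 ^ M)" unfolding of_int_le_iff using 3(2) by linarith
      then have "real_of_int i + 1 \<le> 2 ^ M" by simp
      then have "m \<in> {0<..<1}" using 3 by (simp add: m_def add_nonneg_pos)
      then have gm: "g m \<in> {0<..<1}" using gin by blast
      define k where "k = \<lfloor>g m * 2 ^ K\<rfloor>"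
      define \<xi> where "\<xi> = g m * 2 ^ K - k"
      have \<xi>: "0 \<le> \<xi>" "\<xi> < 1" unfolding \<xi>_def k_def by linarith+
      have k: "k \<in> {0..<2 ^ K}"
      proof -
        have "0 \<le> g m * 2 ^ K" "g m * 2 ^ K < 2 ^ K" using gm by auto
        then show ?thesis unfolding k_def by (auto simp: floor_less_iff)
      qed
      have "m = f ((k + \<xi>) / 2 ^ K)" using g by (simp add: \<xi>_def)
      also have "\<dots> = (j k + \<xi>) / 2 ^ L k" using jL \<xi> by simp
      finally have m: "(real_of_int i + 1/2) / 2 ^ M = (j k + \<xi>) / 2 ^ L k" by (simp add: m_def)
      define D where "D = M - L k"
      have MD: "(2::real) ^ M = 2 ^ L k * 2 ^ D" using LM[OF k] by (simp add: D_def flip: power_add)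
      have "i + 1/2 = (i + 1/2) / 2 ^ M * (2 ^ M :: real)" by simp
      also have "\<dots> = (j k + \<xi>) / 2 ^ L k * (2 ^ L k * 2 ^ D)" by (simp only: m) (simp add: MD)
      also have "\<dots> = (j k + \<xi>) * 2 ^ D" by simp
      finally have "i + 1/2 = (j k + \<xi>) * 2 ^ D" .
      then have r: "(i - j k * 2 ^ D) + 1/2 = \<xi> * 2 ^ D" by (simp add: algebra_simps)
      \<comment> \<open>The position of the \<open>i\<close>-th cell among the \<open>2 ^ D\<close>
        subcells of the image of cell \<open>k\<close>. Integrality turns the bounds on
        \<open>r + 1/2\<close> into \<open>0 \<le> r < 2 ^ D\<close>.\<close>
      define r where "r = i - j k * 2 ^ D"
      have rr: "real_of_int r + 1/2 = \<xi> * 2 ^ D" using r by (simp add: r_def)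
      have "0 \<le> \<xi> * 2 ^ D" "\<xi> * 2 ^ D < 2 ^ D" using \<xi> by auto
      then have "0 \<le> real_of_int r + 1/2" "real_of_int r + 1/2 < real_of_int (2 ^ D)" using rr by auto
      then have "0 \<le> r" "r < 2 ^ D" by linarith+
      then have "real_of_int (r + 1) \<le> real_of_int (2 ^ D)" unfolding of_int_le_iff by linarith
      with \<open>0 \<le> r\<close> have r2: "0 \<le> r" "real_of_int r + 1 \<le> 2 ^ D" by auto
      have "g ((i + x) / 2 ^ M) = ((k * 2 ^ D + r :: int) + x) / 2 ^ (K + D)" if x: "x \<in> {0..1::real}" for x :: real
      proof -
        have "(r + x) / 2 ^ D \<in> {0..1::real}" using x r2 by (auto simp: divide_le_eq)
        then have "f ((k + (r + x) / 2 ^ D) / 2 ^ K) = (j k + (r + x) / 2 ^ D) / 2 ^ L k" using jL by blast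
        also have "\<dots> = (i + x) / 2 ^ M" by (simp add: MD r_def field_simps)
        finally have "g ((i + x) / 2 ^ M) = (k + (r + x) / 2 ^ D) / 2 ^ K" using g by metis
        then show ?thesis by (simp add: field_simps power_add)
      qed
      then show ?thesis by blast
    qed
  qed
  then show ?thesis unfolding carrier_thompsonF thompsonF_elem_iff using gout by auto
qed

lemma thompsonF_inverse:
  assumes "f \<in> carrier thompsonF"
  shows "inv_into UNIV f \<in> carrier thompsonF" "f (inv_into UNIV f x) = x" "inv_into UNIV f (f x) = x"
proof -
  have "f (inv_into UNIV f x) = x" "inv_into UNIV f (f x) = x" for x :: real
    using thompsonF_bij[OF assms] by (auto simp: bij_def surj_f_inv_f)
  then show "inv_into UNIV f \<in> carrier thompsonF" "f (inv_into UNIV f x) = x" "inv_into UNIV f (f x) = x"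
    using inverse_in_thompsonF[OF assms] by blast+
qed

lemma mult_thompsonF: "f \<otimes>\<^bsub>thompsonF\<^esub> g = f \<circ> g" and one_thompsonF: "\<one>\<^bsub>thompsonF\<^esub> = id"
  by (simp_all add: thompsonF_def)

lemma group_thompsonF: "group thompsonF"
proof (rule groupI)
  fix f assume f: "f \<in> carrier thompsonF"
  show "\<exists>g\<in>carrier thompsonF. g \<otimes>\<^bsub>thompsonF\<^esub> f = \<one>\<^bsub>thompsonF\<^esub>"
    using thompsonF_inverse[OF f] by (intro bexI[of _ "inv_into UNIV f"]) (auto simp: mult_thompsonF one_thompsonF)
qed (auto simp: mult_thompsonF one_thompsonF id_in_thompsonF comp_in_thompsonF comp_assoc)

section \<open>Dynamics and normal subgroups of Thompson's group\<close>

text \<open>The conjugate of \<open>f\<close> by the affine map taking \<open>x\<close> to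
  \<open>c + x / 2 ^ e\<close>: a copy of \<open>f\<close> on the interval of length
  \<open>1 / 2 ^ e\<close> that starts at \<open>c\<close>.\<close>

definition rescale :: "nat \<Rightarrow> real \<Rightarrow> (real \<Rightarrow> real) \<Rightarrow> real \<Rightarrow> real" where
  "rescale e c f x = c + f ((x - c) * 2 ^ e) / 2 ^ e"

lemma dyadic_pl_rescale:
  assumes "dyadic_pl K f" "dyadic c"
  shows "\<exists>K. dyadic_pl K (rescale e c f)"
proof -
  obtain m q where c: "c = real_of_int m / 2 ^ q" using assms(2) by (auto simp: dyadic_def)
  have "dyadic_pl (K + q + e) (rescale e c f)" unfolding dyadic_pl_def
  proof
    fix i :: int
    obtain j :: int and L where L: "q \<le> L"
      and j: "\<And>x::real. x \<in> {0..1} \<Longrightarrow>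
        f ((real_of_int (i - m * 2 ^ (e + K)) + x) / 2 ^ (K + q)) = (j + x) / 2 ^ L"
      using dyadic_pl_refine[OF assms(1), of q "i - m * 2 ^ (e + K)"] by blast
    have pL: "(2::real) ^ L = 2 ^ q * 2 ^ (L - q)" using L by (simp flip: power_add)
    have "rescale e c f ((i + x) / 2 ^ (K + q + e)) =
        (real_of_int (j + m * 2 ^ (L - q + e)) + x) / 2 ^ (L + e)" if x: "x \<in> {0..1::real}" for x :: real
    proof -
      have "((i + x) / 2 ^ (K + q + e) - c) * 2 ^ e =
          (real_of_int (i - m * 2 ^ (e + K)) + x) / 2 ^ (K + q)"
        by (simp add: c power_add field_simps)
      then have "rescale e c f ((i + x) / 2 ^ (K + q + e)) = c + (j + x) / 2 ^ L / 2 ^ e"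
        using j[OF x] by (simp add: rescale_def)
      also have "\<dots> = (real_of_int (j + m * 2 ^ (L - q + e)) + x) / 2 ^ (L + e)"
        by (simp add: c pL power_add field_simps)
      finally show ?thesis .
    qed
    then show "\<exists>(j::int) (L::nat). \<forall>x\<in>{0..1::real}.
        rescale e c f ((i + x) / 2 ^ (K + q + e)) = (j + x) / 2 ^ L" by blast
  qed
  then show ?thesis by blast
qed

lemma rescale_outside:
  assumes "f \<in> carrier thompsonF" "x \<notin> {c<..<c + 1 / 2 ^ e}"
  shows "rescale e c f x = x"
proof -
  have "(x - c) * 2 ^ e \<notin> {0<..<1}"
    using assms(2) by (auto simp: field_simps zero_less_mult_iff)
  then have "f ((x - c) * 2 ^ e) = (x - c) * 2 ^ e" using thompsonF_outside assms(1) by blast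
  then show ?thesis by (simp add: rescale_def)
qed

lemma rescale_in_thompsonF:
  assumes f: "f \<in> carrier thompsonF" and c: "dyadic c" "0 \<le> c" "c + 1 / 2 ^ e \<le> 1"
  shows "rescale e c f \<in> carrier thompsonF"
proof -
  have "rescale e c f x = x" if "x \<notin> {0<..<1}" for x
    using rescale_outside[OF f, of x c e] that c by auto
  then show ?thesis
    using f dyadic_pl_rescale[OF _ c(1)] unfolding carrier_thompsonF thompsonF_elem_iff by auto
qed

lemma rescale_comp: "rescale e c (f \<circ> g) = rescale e c f \<circ> rescale e c g"
  by (auto simp: rescale_def fun_eq_iff)

lemma rescale_inj:
  assumes "rescale e c f = rescale e c g"
  shows "f = g"
proof
  fix y
  have "rescale e c f (c + y / 2 ^ e) = rescale e c g (c + y / 2 ^ e)" using assms by simp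
  then show "f y = g y" by (simp add: rescale_def)
qed

text \<open>A classical generator of Thompson's group with slopes 1/2, 1 and 2. It serves as an
  element that moves every point of the open unit interval.\<close>

definition x0 :: "real \<Rightarrow> real" where
  "x0 x = (if x \<le> 0 \<or> 1 \<le> x then x else if x \<le> 1/2 then x / 2 else if x \<le> 3/4 then x - 1/4 else 2 * x - 1)"

lemma x0_in_thompsonF: "x0 \<in> carrier thompsonF"
proof -
  have "\<exists>(j::int) (L::nat). \<forall>x\<in>{0..1::real}. x0 ((i + x) / 2 ^ 2) = (j + x) / 2 ^ L" for i :: int
  proof -
    consider "i < 0" | "i = 0" | "i = 1" | "i = 2" | "i = 3" | "i \<ge> 4" by linarith
    then show ?thesis
    proof cases
      case 1
      then have "\<forall>x\<in>{0..1::real}. x0 ((i + x) / 2 ^ 2) = (i + x) / 2 ^ 2" by (auto simp: x0_def)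
      then show ?thesis by blast
    next
      case 2
      then have "\<forall>x\<in>{0..1::real}. x0 ((i + x) / 2 ^ 2) = (real_of_int 0 + x) / 2 ^ 3" by (auto simp: x0_def)
      then show ?thesis by blast
    next
      case 3
      then have "\<forall>x\<in>{0..1::real}. x0 ((i + x) / 2 ^ 2) = (real_of_int 1 + x) / 2 ^ 3" by (auto simp: x0_def)
      then show ?thesis by blast
    next
      case 4
      then have "\<forall>x\<in>{0..1::real}. x0 ((i + x) / 2 ^ 2) = (real_of_int 1 + x) / 2 ^ 2"
        by (auto simp: x0_def field_simps)
      then show ?thesis by blast
    next
      case 5
      then have "\<forall>x\<in>{0..1::real}. x0 ((i + x) / 2 ^ 2) = (real_of_int 1 + x) / 2 ^ 1"
        by (auto simp: x0_def field_simps)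
      then show ?thesis by blast
    next
      case 6
      then have "\<forall>x\<in>{0..1::real}. x0 ((i + x) / 2 ^ 2) = (i + x) / 2 ^ 2" by (auto simp: x0_def)
      then show ?thesis by blast
    qed
  qed
  then have "dyadic_pl 2 x0" unfolding dyadic_pl_def by blast
  then show ?thesis unfolding carrier_thompsonF thompsonF_elem_iff by (auto simp: x0_def)
qed

lemma x0_less: "x \<in> {0<..<1} \<Longrightarrow> x0 x < x"
  by (auto simp: x0_def)

definition local_thompsonF :: "real \<Rightarrow> real \<Rightarrow> (real \<Rightarrow> real) set" where
  "local_thompsonF l r = {f \<in> carrier thompsonF. \<forall>x. x \<notin> {l<..<r} \<longrightarrow> f x = x}"

lemma homeo_group_local: "homeo_group (local_thompsonF l r)"
proof -
  have "\<exists>f'\<in>local_thompsonF l r. f \<circ> f' = id \<and> f' \<circ> f = id" if f: "f \<in> local_thompsonF l r" for f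
  proof -
    have fF: "f \<in> carrier thompsonF" using f by (simp add: local_thompsonF_def)
    have "inv_into UNIV f x = x" if "x \<notin> {l<..<r}" for x
      using thompsonF_inverse(3)[OF fF, of x] f that by (auto simp: local_thompsonF_def)
    then show ?thesis
      using thompsonF_inverse[OF fF]
      by (intro bexI[of _ "inv_into UNIV f"]) (auto simp: local_thompsonF_def)
  qed
  then show ?thesis
    unfolding homeo_group_def
    by (auto simp: local_thompsonF_def id_in_thompsonF comp_in_thompsonF thompsonF_strict_mono)
qed

text \<open>A rescaled copy of \<open>x0\<close>, placed on a short dyadic interval around the
  point, moves it.\<close>

lemma moved_local:
  assumes "0 \<le> l" "r \<le> 1"
  shows "{l<..<r} \<subseteq> moved (local_thompsonF l r)"
proof
  fix x assume x: "x \<in> {l<..<r}"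
  define \<delta> where "\<delta> = min (x - l) (r - x)"
  have "\<delta> > 0" using x by (simp add: \<delta>_def)
  then obtain e where e: "(1/2) ^ e < \<delta>" using real_arch_pow_inv[of \<delta> "1/2"] by auto
  \<comment> \<open>Ceiling minus one makes \<open>c < x\<close> strict even at grid points. Since
    \<open>x\<close> is then in the left half of the interval of length \<open>1 / 2 ^ e\<close> at
    \<open>c\<close>, it is interior to it.\<close>
  define i where "i = \<lceil>x * 2 ^ Suc e\<rceil> - 1"
  define c where "c = i / 2 ^ Suc e"
  have "real_of_int i < x * 2 ^ Suc e" "x * 2 ^ Suc e \<le> i + 1" unfolding i_def by linarith+
  then have c: "c < x" "x \<le> c + 1 / 2 ^ Suc e"
    unfolding c_def by (simp_all add: field_simps)
  have e': "1 / 2 ^ e < x - l" "1 / 2 ^ e < r - x" using e by (auto simp: \<delta>_def power_one_over)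
  have h: "(1::real) / 2 ^ Suc e < 1 / 2 ^ e" by (simp add: field_simps)
  have lc: "l \<le> c" "c + 1 / 2 ^ e \<le> r" "x < c + 1 / 2 ^ e" using c e' h by linarith+
  have "dyadic c" unfolding c_def dyadic_def by blast
  then have F: "rescale e c x0 \<in> carrier thompsonF"
    using rescale_in_thompsonF[OF x0_in_thompsonF] lc assms by auto
  moreover have "rescale e c x0 y = y" if "y \<notin> {l<..<r}" for y
    using rescale_outside[OF x0_in_thompsonF, of y c e] that lc by auto
  ultimately have "rescale e c x0 \<in> local_thompsonF l r" by (auto simp: local_thompsonF_def)
  moreover have "rescale e c x0 x \<noteq> x"
  proof
    assume "rescale e c x0 x = x"
    then have "x0 ((x - c) * 2 ^ e) = (x - c) * 2 ^ e" by (simp add: rescale_def field_simps)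
    moreover have "(x - c) * 2 ^ e \<in> {0<..<1}" using c lc by (simp add: field_simps)
    ultimately show False using x0_less by fastforce
  qed
  ultimately show "x \<in> moved (local_thompsonF l r)" by (auto simp: moved_def)
qed

lemma thompsonF_moves: "z \<in> {0<..<1} \<Longrightarrow> \<exists>f\<in>carrier thompsonF. f z \<noteq> z"
  using moved_local[of 0 1] by (auto simp: moved_def local_thompsonF_def)

lemma local_push_up:
  assumes "0 \<le> l" "r \<le> 1" "y \<in> {l<..<r}" "z \<in> {l<..<r}"
  obtains f where "f \<in> local_thompsonF l r" "z < f y"
proof -
  have "{y..z} \<subseteq> moved (local_thompsonF l r)" using moved_local[OF assms(1,2)] assms(3,4) by force
  then show thesis using push_beyond[OF homeo_group_local] that by blast
qed

lemma local_push_down: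
  assumes "0 \<le> l" "r \<le> 1" "y \<in> {l<..<r}" "z \<in> {l<..<r}"
  obtains f where "f \<in> local_thompsonF l r" "f y < z"
proof -
  obtain f where f: "f \<in> local_thompsonF l r" "y < f z" using local_push_up assms by blast
  obtain f' where f': "f' \<in> local_thompsonF l r" "\<And>x. f' (f x) = x"
    using homeo_group_inverse[OF homeo_group_local f(1)] by metis
  have "f' y < f' (f z)" using homeo_groupD(3)[OF homeo_group_local f'(1)] f(2) strict_monoD by blast
  then show thesis using that f' by simp
qed

text \<open>The elements are supported in \<open>{0<..<3/4}\<close> and \<open>{1/4<..<1}\<close>
  and throw \<open>1/2\<close> out of the overlap on opposite sides. The jumps force large
  derivatives; the last two equations show that \<open>f\<close> and \<open>g\<close> do not commute
  at \<open>1/2\<close>.\<close>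

lemma jump_pair:
  obtains f g where "f \<in> carrier thompsonF" "g \<in> carrier thompsonF"
    "f (3/4) = 3/4" "g (1/4) = 1/4" "f (1/2) < 1/4" "3/4 < g (1/2)"
    "f (g (1/2)) = g (1/2)" "g (f (1/2)) = f (1/2)"
proof -
  obtain f where f: "f \<in> local_thompsonF 0 (3/4)" "f (1/2) < 1/4"
    using local_push_down[of 0 "3/4" "1/2" "1/4"] by auto
  obtain g where g: "g \<in> local_thompsonF (1/4) 1" "3/4 < g (1/2)"
    using local_push_up[of "1/4" 1 "1/2" "3/4"] by auto
  show thesis using that[of f g] f g by (auto simp: local_thompsonF_def)
qed

section \<open>Commutators contained in nontrivial normal subgroups\<close>

definition commutator :: "(real \<Rightarrow> real) \<Rightarrow> (real \<Rightarrow> real) \<Rightarrow> real \<Rightarrow> real" where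
  "commutator f g = f \<circ> g \<circ> inv_into UNIV f \<circ> inv_into UNIV g"

lemma commutator_in_thompsonF:
  "f \<in> carrier thompsonF \<Longrightarrow> g \<in> carrier thompsonF \<Longrightarrow> commutator f g \<in> carrier thompsonF"
  by (simp add: commutator_def comp_in_thompsonF thompsonF_inverse)

text \<open>The two pushes are supported on opposite sides of an intermediate point
  \<open>c\<close>, so neither disturbs the other.\<close>

lemma expand_interval:
  assumes "0 < \<alpha>" "\<alpha> < \<beta>" "\<beta> < 1"
  obtains g where "g \<in> carrier thompsonF" "g \<alpha> < 1/4" "3/4 < g \<beta>"
proof -
  obtain c where c: "\<alpha> < c" "c < \<beta>" using dense assms by blast
  obtain g1 where g1: "g1 \<in> local_thompsonF 0 c" "g1 \<alpha> < min (1/4) \<alpha>"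
    using local_push_down[of 0 c \<alpha> "min (1/4) \<alpha>"] assms c by (auto simp: min_less_iff_disj)
  obtain g2 where g2: "g2 \<in> local_thompsonF c 1" "max (3/4) \<beta> < g2 \<beta>"
    using local_push_up[of c 1 \<beta> "max (3/4) \<beta>"] assms c by (auto simp: less_max_iff_disj)
  have "g2 \<alpha> = \<alpha>" using g2 c by (auto simp: local_thompsonF_def)
  moreover have "g1 (g2 \<beta>) = g2 \<beta>" using g1 g2 c by (auto simp: local_thompsonF_def)
  ultimately show thesis
    using that[of "g1 \<circ> g2"] g1 g2 comp_in_thompsonF by (auto simp: local_thompsonF_def)
qed

lemma displaced_interval:
  assumes n: "n \<in> carrier thompsonF" "n \<noteq> id"
  obtains \<alpha> \<beta> where "0 < \<alpha>" "\<alpha> < \<beta>" "\<beta> < 1" "\<And>y. \<alpha> \<le> y \<Longrightarrow> y \<le> \<beta> \<Longrightarrow> n y \<notin> {\<alpha>..\<beta>}"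
proof -
  obtain x where x: "n x \<noteq> x" using n(2) by (auto simp: fun_eq_iff)
  have x01: "x \<in> {0<..<1}" "n x \<in> {0<..<1}"
    using x thompsonF_outside[OF n(1)] thompsonF_inside[OF n(1)] by blast+
  have mono: "y \<le> z \<Longrightarrow> n y \<le> n z" for y z
    using strict_mono_less_eq[OF thompsonF_strict_mono[OF n(1)]] by blast
  show thesis
  proof (cases "x < n x")
    case True
    then obtain \<beta> where "x < \<beta>" "\<beta> < n x" using dense by blast
    then show thesis using that[of x \<beta>] x01 mono[of x] by fastforce
  next
    case False
    then obtain \<alpha> where "n x < \<alpha>" "\<alpha> < x" using dense x by (metis linorder_neqE)
    then show thesis using that[of \<alpha> x] x01 mono[of _ x] by fastforce
  qed
qed

text \<open>The double commutator argument: conjugation by \<open>h\<close> brings the supports of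
  \<open>f\<close> and \<open>g\<close> into an interval displaced by \<open>n\<close>. There their
  commutator equals one with an entry in \<open>N\<close>, and normality carries it back.\<close>

lemma commutator_in_normal:
  assumes NF: "N \<subseteq> carrier thompsonF"
    and Ncomp: "\<And>m n. m \<in> N \<Longrightarrow> n \<in> N \<Longrightarrow> m \<circ> n \<in> N"
    and Ninv: "\<And>n. n \<in> N \<Longrightarrow> inv_into UNIV n \<in> N"
    and Nconj: "\<And>n h. n \<in> N \<Longrightarrow> h \<in> carrier thompsonF \<Longrightarrow> h \<circ> n \<circ> inv_into UNIV h \<in> N"
    and n: "n \<in> N" "n \<noteq> id"
    and f: "f \<in> carrier thompsonF" "\<And>x. x \<notin> {1/4..3/4} \<Longrightarrow> f x = x"
    and g: "g \<in> carrier thompsonF" "\<And>x. x \<notin> {1/4..3/4} \<Longrightarrow> g x = x"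
  shows "commutator f g \<in> N"
proof -
  define inve :: "(real \<Rightarrow> real) \<Rightarrow> real \<Rightarrow> real" where "inve = inv_into UNIV"
  have iF: "h \<in> carrier thompsonF \<Longrightarrow> inve h \<in> carrier thompsonF" for h
    using thompsonF_inverse by (simp add: inve_def)
  have i1: "h \<in> carrier thompsonF \<Longrightarrow> h (inve h x) = x" for h x
    using thompsonF_inverse by (simp add: inve_def)
  have i2: "h \<in> carrier thompsonF \<Longrightarrow> inve h (h x) = x" for h x
    using thompsonF_inverse by (simp add: inve_def)
  have nF: "n \<in> carrier thompsonF" using n NF by blast
  obtain \<alpha> \<beta> where \<alpha>\<beta>: "0 < \<alpha>" "\<alpha> < \<beta>" "\<beta> < 1" "\<And>y. \<alpha> \<le> y \<Longrightarrow> y \<le> \<beta> \<Longrightarrow> n y \<notin> {\<alpha>..\<beta>}"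
    using displaced_interval[OF nF n(2)] by metis
  obtain h where h: "h \<in> carrier thompsonF" "h \<alpha> < 1/4" "3/4 < h \<beta>"
    using expand_interval \<alpha>\<beta> by metis
  have hm: "strict_mono h" using h thompsonF_strict_mono by blast
  have hout: "h x \<notin> {1/4..3/4}" if "x \<notin> {\<alpha>..\<beta>}" for x
    using that h strict_monoD[OF hm, of x \<alpha>] strict_monoD[OF hm, of \<beta> x] by force
  define f1 g1 where "f1 = inve h \<circ> f \<circ> h" and "g1 = inve h \<circ> g \<circ> h"
  define f1' where "f1' = inve h \<circ> inve f \<circ> h"
  have fg1: "f1 \<in> carrier thompsonF" "g1 \<in> carrier thompsonF" "f1' \<in> carrier thompsonF"
    using f g h iF comp_in_thompsonF by (auto simp: f1_def g1_def f1'_def)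
  have f1f1': "f1 (f1' x) = x" "f1' (f1 x) = x" for x
    by (simp_all add: f1_def f1'_def i1[OF h(1)] i2[OF h(1)] i1[OF f(1)] i2[OF f(1)])
  have out: "f1 x = x" "g1 x = x" "f1' x = x" if "x \<notin> {\<alpha>..\<beta>}" for x
  proof -
    show "f1 x = x" "g1 x = x"
      using hout[OF that] f(2) g(2) i2[OF h(1)] by (simp_all add: f1_def g1_def)
    then show "f1' x = x" using f1f1'(2)[of x] by simp
  qed
  \<comment> \<open>\<open>q\<close> is the inverse of \<open>f1\<close> transported by \<open>n\<close> off the support of \<open>g1\<close>, so in the commutator of
    \<open>k = f1 q \<in> N\<close> with \<open>g1\<close> the factor \<open>q\<close> cancels\<close>
  define q q' where "q = n \<circ> f1' \<circ> inve n" and "q' = n \<circ> f1 \<circ> inve n"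
  have qq': "q (q' x) = x" for x using f1f1' i1[OF nF] i2[OF nF] by (simp add: q_def q'_def)
  have qid: "q x = x" if "x \<in> {\<alpha>..\<beta>}" for x
  proof -
    have "inve n x \<notin> {\<alpha>..\<beta>}" using \<alpha>\<beta>(4)[of "inve n x"] i1[OF nF] that by auto
    then show ?thesis using out i1[OF nF] by (simp add: q_def)
  qed
  have inj: "inj q" "inj g1"
  proof -
    show "inj q" by (rule inj_on_inverseI[of _ q']) (simp add: q_def q'_def f1f1' i1[OF nF] i2[OF nF])
    show "inj g1" using thompsonF_bij[OF fg1(2)] by (simp add: bij_def)
  qed
  have qg: "q (g1 x) = g1 (q x)" for x
  proof (rule commute_if_disjoint_supports[where E = UNIV])
    show "q y = y \<or> g1 y = y" for y using qid out by blast
  qed (use inj in auto)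
  define k where "k = f1 \<circ> n \<circ> f1' \<circ> inve n"
  have f1'i: "f1' = inve f1" using f1f1' i1[OF fg1(1)] i2[OF fg1(1)] by (metis ext)
  have kN: "k \<in> N"
    using Ncomp[OF Nconj[OF n(1) fg1(1)] Ninv[OF n(1)]] by (simp add: k_def f1'i inve_def)
  have kF: "k \<in> carrier thompsonF" using kN NF by blast
  have k: "k x = f1 (q x)" for x by (simp add: k_def q_def)
  have k': "inve k x = q' (f1' x)" for x
    using i2[OF kF, of "q' (f1' x)"] by (simp add: k qq' f1f1')
  have "k \<circ> (g1 \<circ> inve k \<circ> inve g1) \<in> N"
    using Ncomp[OF kN Nconj[OF Ninv[OF kN] fg1(2)]] by (simp add: inve_def)
  moreover have "k \<circ> (g1 \<circ> inve k \<circ> inve g1) = f1 \<circ> g1 \<circ> f1' \<circ> inve g1"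
    by (simp add: fun_eq_iff k k' qg qq')
  ultimately have c1: "f1 \<circ> g1 \<circ> f1' \<circ> inve g1 \<in> N" by simp
  have "inve g1 x = inve h (inve g (h x))" for x
    using i2[OF fg1(2), of "inve h (inve g (h x))"] by (simp add: g1_def i1[OF h(1)] i2[OF h(1)] i1[OF g(1)])
  then have "h \<circ> (f1 \<circ> g1 \<circ> f1' \<circ> inve g1) \<circ> inve h = commutator f g"
    using i1[OF h(1)] by (simp add: fun_eq_iff f1_def g1_def f1'_def commutator_def inve_def)
  then show ?thesis using Nconj[OF c1 h(1)] by (simp add: inve_def)
qed

section \<open>Actions of Thompson's group by diffeomorphisms\<close>

lemma compact_level_set:
  fixes h :: "real \<Rightarrow> real"
  assumes "continuous_on {p..q} h"
  shows "compact {x \<in> {p..q}. h x = z}"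
proof -
  have "closed {x \<in> {p..q}. h x = z}"
    using continuous_closed_preimage_constant[OF assms] by simp
  moreover have "{x \<in> {p..q}. h x = z} = {p..q} \<inter> {x \<in> {p..q}. h x = z}" by blast
  ultimately show ?thesis using compact_Int_closed[OF compact_Icc] by metis
qed

lemma mvt_unit_interval:
  assumes "\<And>x. x \<in> {0..1} \<Longrightarrow> (f has_real_derivative D x) (at x within {0..1})"
    "0 \<le> a" "a < b" "b \<le> 1"
  obtains \<xi> where "a < \<xi>" "\<xi> < b" "f b - f a = D \<xi> * (b - a)"
proof -
  have "(f has_derivative (\<lambda>h. D x * h)) (at x within {a..b})" if "a \<le> x" "x \<le> b" for x
    using has_field_derivative_subset[OF assms(1)[of x], of "{a..b}"] that assms(2-4)
    by (auto simp: has_field_derivative_def)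
  then obtain \<xi> where "\<xi> \<in> {a<..<b}" "f b - f a = D \<xi> * (b - a)"
    using mvt_simple[OF assms(3), of f "\<lambda>x h. D x * h"] by blast
  then show thesis using that by auto
qed

text \<open>\<open>F1\<close> stretches \<open>{y..t}\<close> over more than \<open>{s..t}\<close>,
  and \<open>F2\<close> does the same to \<open>{s..y}\<close>. The shorter of the two has at most
  half the total length, so the mean value theorem gives a derivative of at least 2 there.\<close>

lemma two_jumps:
  fixes F1 F2 D1 D2 :: "real \<Rightarrow> real" and s y t :: real
  assumes jumps: "F1 y < s" "s < y" "y < t" "t < F2 y" and fixed: "F1 t = t" "F2 s = s"
    and st: "0 \<le> s" "t \<le> 1"
    and D1: "\<And>x. x \<in> {0..1} \<Longrightarrow> (F1 has_real_derivative D1 x) (at x within {0..1})"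
    and D2: "\<And>x. x \<in> {0..1} \<Longrightarrow> (F2 has_real_derivative D2 x) (at x within {0..1})"
  shows "\<exists>\<xi>. s < \<xi> \<and> \<xi> < t \<and> (2 \<le> D1 \<xi> \<or> 2 \<le> D2 \<xi>)"
proof -
  obtain \<xi> where \<xi>: "y < \<xi>" "\<xi> < t" "F1 t - F1 y = D1 \<xi> * (t - y)"
    using mvt_unit_interval[OF D1, of y t] jumps st by auto
  obtain \<eta> where \<eta>: "s < \<eta>" "\<eta> < y" "F2 y - F2 s = D2 \<eta> * (y - s)"
    using mvt_unit_interval[OF D2, of s y] jumps st by auto
  show ?thesis
  proof (cases "t - y \<le> y - s")
    case True
    have "2 * (t - y) \<le> F1 t - F1 y" using jumps(1) fixed(1) True by simp
    then have "2 * (t - y) \<le> D1 \<xi> * (t - y)" using \<xi>(3) by simp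
    then have "2 \<le> D1 \<xi>" using jumps(3) by (simp only: mult_le_cancel_right_pos diff_gt_0_iff_gt)
    then show ?thesis using \<xi> jumps by (intro exI[of _ \<xi>]) auto
  next
    case False
    have "2 * (y - s) \<le> F2 y - F2 s" using jumps(4) fixed(2) False by simp
    then have "2 * (y - s) \<le> D2 \<eta> * (y - s)" using \<eta>(3) by simp
    then have "2 \<le> D2 \<eta>" using jumps(2) by (simp only: mult_le_cancel_right_pos diff_gt_0_iff_gt)
    then show ?thesis using \<eta> jumps by (intro exI[of _ \<eta>]) auto
  qed
qed

lemma diff1_plus_strict_mono:
  assumes "diff1_plus f"
  shows "strict_mono f"
proof -
  have out: "f x = x" if "x \<notin> {0..1}" for x using assms that by (auto simp: diff1_plus_def)
  have into: "f x \<in> {0..1}" if "x \<in> {0..1}" for x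
    using assms that by (auto simp: diff1_plus_def dest: bij_betw_apply)
  obtain D where D: "\<And>x. x \<in> {0..1} \<Longrightarrow> (f has_real_derivative D x) (at x within {0..1})"
    "\<And>x. x \<in> {0..1} \<Longrightarrow> D x > 0"
    using assms unfolding diff1_plus_def by blast
  have "f x < f y" if xy: "x < y" "x \<in> {0..1}" "y \<in> {0..1}" for x y
  proof -
    obtain \<xi> where \<xi>: "x < \<xi>" "\<xi> < y" "f y - f x = D \<xi> * (y - x)"
      using mvt_unit_interval[of f D x y] D(1) xy by auto
    have "D \<xi> > 0" using D(2) \<xi> xy by auto
    then show ?thesis using \<xi> xy by (metis diff_gt_0_iff_gt mult_pos_pos)
  qed
  moreover have "f x < f y" if xy: "x < y" "x \<notin> {0..1} \<or> y \<notin> {0..1}" for x y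
    using xy into[of x] into[of y] out[of x] out[of y] by (cases "x \<in> {0..1}"; cases "y \<in> {0..1}") auto
  ultimately show ?thesis by (meson strict_monoI)
qed

lemma diff1_plus_outside: "diff1_plus f \<Longrightarrow> x \<notin> {0..1} \<Longrightarrow> f x = x"
  by (simp add: diff1_plus_def)

section \<open>Differentiable actions of Thompson's group and their components\<close>

locale thompsonF_action =
  fixes \<rho> :: "(real \<Rightarrow> real) \<Rightarrow> real \<Rightarrow> real"
  assumes hom: "\<rho> \<in> hom thompsonF Diff1_plus_I"
begin

lemma diff: "f \<in> carrier thompsonF \<Longrightarrow> diff1_plus (\<rho> f)"
  using hom by (auto simp: hom_def Diff1_plus_I_def)

lemma comp: "f \<in> carrier thompsonF \<Longrightarrow> g \<in> carrier thompsonF \<Longrightarrow> \<rho> (f \<circ> g) x = \<rho> f (\<rho> g x)"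
  using hom by (simp add: hom_def Diff1_plus_I_def mult_thompsonF)

lemma smono: "f \<in> carrier thompsonF \<Longrightarrow> strict_mono (\<rho> f)"
  using diff diff1_plus_strict_mono by blast

lemma at_id: "\<rho> id x = x"
  using comp[OF id_in_thompsonF id_in_thompsonF, of x] strict_mono_eq[OF smono[OF id_in_thompsonF]]
  by simp

lemma at_inverse:
  assumes "f \<in> carrier thompsonF"
  shows "\<rho> (inv_into UNIV f) (\<rho> f x) = x" "\<rho> f (\<rho> (inv_into UNIV f) x) = x"
proof -
  have "inv_into UNIV f \<circ> f = id" "f \<circ> inv_into UNIV f = id"
    using thompsonF_inverse[OF assms] by auto
  then show "\<rho> (inv_into UNIV f) (\<rho> f x) = x" "\<rho> f (\<rho> (inv_into UNIV f) x) = x"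
    using comp thompsonF_inverse(1)[OF assms] assms at_id by metis+
qed

abbreviation \<Gamma> where "\<Gamma> \<equiv> \<rho> ` carrier thompsonF"

lemma homeo_group_\<Gamma>: "homeo_group \<Gamma>"
proof -
  have "id = \<rho> id" using at_id by auto
  then have "id \<in> \<Gamma>" using id_in_thompsonF by (metis imageI)
  moreover have "\<rho> f \<circ> \<rho> g = \<rho> (f \<circ> g)" if "f \<in> carrier thompsonF" "g \<in> carrier thompsonF" for f g
    using comp that by auto
  then have "\<forall>f\<in>\<Gamma>. \<forall>g\<in>\<Gamma>. f \<circ> g \<in> \<Gamma>" using comp_in_thompsonF by auto
  moreover have "\<exists>f'\<in>\<Gamma>. \<rho> f \<circ> f' = id \<and> f' \<circ> \<rho> f = id" if "f \<in> carrier thompsonF" for f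
    using at_inverse[OF that] thompsonF_inverse(1)[OF that]
    by (intro bexI[of _ "\<rho> (inv_into UNIV f)"]) auto
  ultimately show ?thesis using smono unfolding homeo_group_def by auto
qed

lemma moved_subset: "moved \<Gamma> \<subseteq> {0..1}"
  using diff1_plus_outside[OF diff] unfolding moved_def by blast

lemma supp_action_eq: "supp_action thompsonF \<rho> = moved \<Gamma>"
  using moved_subset unfolding supp_action_def moved_def by blast

text \<open>The elements acting trivially on the invariant set \<open>J\<close> form a normal
  subgroup. Two elements that agree on \<open>J\<close> make it nontrivial, so
  \<open>commutator_in_normal\<close> applies.\<close>

lemma nonfaithful_commutator:
  assumes J: "J \<in> components (moved \<Gamma>)" and nf: "\<not> faithful_on thompsonF \<rho> J"
    and f: "f \<in> carrier thompsonF" "\<And>x. x \<notin> {1/4..3/4} \<Longrightarrow> f x = x"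
    and g: "g \<in> carrier thompsonF" "\<And>x. x \<notin> {1/4..3/4} \<Longrightarrow> g x = x"
    and x: "x \<in> J"
  shows "\<rho> (commutator f g) x = x"
proof -
  define N where "N = {n \<in> carrier thompsonF. \<forall>x\<in>J. \<rho> n x = x}"
  obtain g1 g2 where g12: "g1 \<in> carrier thompsonF" "g2 \<in> carrier thompsonF" "g1 \<noteq> g2"
    "restrict (\<rho> g1) J = restrict (\<rho> g2) J"
    using nf by (auto simp: faithful_on_def inj_on_def)
  define n where "n = inv_into UNIV g1 \<circ> g2"
  have nF: "n \<in> carrier thompsonF"
    using g12 thompsonF_inverse comp_in_thompsonF by (simp add: n_def)
  have "\<rho> g2 y = \<rho> g1 y" if "y \<in> J" for y using g12(4) that by (metis restrict_apply')
  then have nN: "n \<in> N"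
    using nF comp thompsonF_inverse(1) g12 at_inverse by (auto simp: N_def n_def)
  have nid: "n \<noteq> id"
  proof
    assume "n = id"
    then have "g1 (inv_into UNIV g1 (g2 y)) = g1 y" for y by (simp add: n_def fun_eq_iff)
    then have "g2 y = g1 y" for y using thompsonF_inverse(2)[OF g12(1)] by simp
    then show False using g12(3) by auto
  qed
  have inJ: "\<rho> h y \<in> J \<longleftrightarrow> y \<in> J" if "h \<in> carrier thompsonF" for h y
    using component_invariant[OF homeo_group_\<Gamma> J moved_subset] that by blast
  have "commutator f g \<in> N"
  proof (rule commutator_in_normal[OF _ _ _ _ nN nid f g])
    show "N \<subseteq> carrier thompsonF" by (auto simp: N_def)
    show "m \<circ> n \<in> N" if "m \<in> N" "n \<in> N" for m n
      using that comp comp_in_thompsonF by (auto simp: N_def)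
    show "inv_into UNIV n \<in> N" if n: "n \<in> N" for n
    proof -
      have nF: "n \<in> carrier thompsonF" using n by (simp add: N_def)
      have "\<rho> (inv_into UNIV n) y = y" if "y \<in> J" for y
        using at_inverse(1)[OF nF, of y] n that by (simp add: N_def)
      then show ?thesis using thompsonF_inverse(1)[OF nF] by (simp add: N_def)
    qed
    show "h \<circ> n \<circ> inv_into UNIV h \<in> N" if n: "n \<in> N" and h: "h \<in> carrier thompsonF" for n h
    proof -
      have i: "inv_into UNIV h \<in> carrier thompsonF" using h thompsonF_inverse by blast
      have nF: "n \<in> carrier thompsonF" using n by (simp add: N_def)
      have "\<rho> (h \<circ> n \<circ> inv_into UNIV h) y = y" if "y \<in> J" for y
      proof -
        have "\<rho> n (\<rho> (inv_into UNIV h) y) = \<rho> (inv_into UNIV h) y"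
          using n inJ[OF i] that by (simp add: N_def)
        then show ?thesis
          using comp[OF comp_in_thompsonF[OF h nF] i] comp[OF h nF] at_inverse[OF h] by simp
      qed
      then show ?thesis using comp_in_thompsonF h i nF by (simp add: N_def)
    qed
  qed
  then show ?thesis using x by (simp add: N_def)
qed

text \<open>The points 1/4, 1/2 and 3/4 lift through the semi-conjugacy to the configuration of
  \<open>two_jumps\<close>, with the lifts of 1/4 and 3/4 fixed by \<open>g\<close> and
  \<open>f\<close>.\<close>

lemma semiconj_expansion:
  assumes pq: "p < q" "0 \<le> p" "q \<le> 1"
    and ends: "p \<notin> moved \<Gamma>" "q \<notin> moved \<Gamma>"
    and sc: "semiconj_standard \<rho> {p<..<q}"
    and fg: "f \<in> carrier thompsonF" "g \<in> carrier thompsonF"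
      "f (3/4) = 3/4" "g (1/4) = 1/4" "f (1/2) < 1/4" "3/4 < g (1/2)"
    and Df: "\<And>x. x \<in> {0..1} \<Longrightarrow> (\<rho> f has_real_derivative Df x) (at x within {0..1})"
    and Dg: "\<And>x. x \<in> {0..1} \<Longrightarrow> (\<rho> g has_real_derivative Dg x) (at x within {0..1})"
  shows "\<exists>\<xi>\<in>{p<..<q}. 2 \<le> Df \<xi> \<or> 2 \<le> Dg \<xi>"
proof -
  have cl: "closure {p<..<q} = {p..q}" using pq by simp
  obtain h where h: "mono_on {p..q} h \<or> antimono_on {p..q} h" "h ` {p..q} = {0..1}"
    "continuous_on {p..q} h" "\<And>g x. g \<in> carrier thompsonF \<Longrightarrow> x \<in> {p..q} \<Longrightarrow> h (\<rho> g x) = g (h x)"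
    using sc unfolding semiconj_standard_def cl by blast
  have inv: "\<rho> k x \<in> {p..q}" if "k \<in> carrier thompsonF" "x \<in> {p..q}" for k x
  proof -
    have "\<rho> k p = p" "\<rho> k q = q" using ends that by (auto simp: moved_def)
    then show ?thesis using that strict_mono_less_eq[OF smono[OF that(1)]] by (metis atLeastAtMost_iff)
  qed
  \<comment> \<open>An element fixing \<open>z\<close> preserves the fibre over \<open>z\<close>,
    and so does its inverse; hence it fixes the least point of the fibre.\<close>
  have lift: "\<exists>a\<in>{p..q}. h a = z \<and> (\<forall>k\<in>carrier thompsonF. k z = z \<longrightarrow> \<rho> k a = a)" if z: "z \<in> {0..1}" for z
  proof -
    define T where "T = {x \<in> {p..q}. h x = z}"
    have cT: "compact T" unfolding T_def using h(3) by (rule compact_level_set)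
    have "z \<in> h ` {p..q}" using z h(2) by simp
    then obtain x where xT: "x \<in> T" by (auto simp: T_def)
    obtain a b where a: "a \<in> T" "b \<in> T" "a \<le> x" "x \<le> b"
      "\<forall>f f'. strict_mono f \<longrightarrow> (\<forall>y. f (f' y) = y) \<longrightarrow> f ` T \<subseteq> T \<longrightarrow> f' ` T \<subseteq> T \<longrightarrow> f a = a \<and> f b = b"
      using fiber_ends[OF cT xT] by blast
    have "\<rho> k a = a" if k: "k \<in> carrier thompsonF" "k z = z" for k
    proof (rule a(5)[rule_format, THEN conjunct1])
      have k': "inv_into UNIV k \<in> carrier thompsonF" "inv_into UNIV k z = z"
        using thompsonF_inverse[OF k(1)] k(2) by metis+
      show "\<rho> k ` T \<subseteq> T" "\<rho> (inv_into UNIV k) ` T \<subseteq> T"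
        using h(4)[OF k(1)] h(4)[OF k'(1)] inv[OF k(1)] inv[OF k'(1)] k(2) k'(2) by (auto simp: T_def)
    qed (use smono at_inverse k in auto)
    then show ?thesis using a(1) by (auto simp: T_def)
  qed
  obtain s where s: "s \<in> {p..q}" "h s = 1/4" "\<rho> g s = s" using lift[of "1/4"] fg by auto
  obtain t where t: "t \<in> {p..q}" "h t = 3/4" "\<rho> f t = t" using lift[of "3/4"] fg by auto
  obtain y where y: "y \<in> {p..q}" "h y = 1/2" using lift[of "1/2"] by auto
  have fy: "\<rho> f y \<in> {p..q}" "\<rho> g y \<in> {p..q}" using inv fg y by auto
  have hfy: "h (\<rho> f y) < h s" "h s < h y" "h y < h t" "h t < h (\<rho> g y)"
    using h(4)[OF _ y(1)] fg y s t by auto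
  show ?thesis
  proof (cases "mono_on {p..q} h")
    case True
    then have lt: "a < b" if "h a < h b" "a \<in> {p..q}" "b \<in> {p..q}" for a b
      using that by (meson monotone_onD not_le)
    have ineq: "\<rho> f y < s" "s < y" "y < t" "t < \<rho> g y"
      using lt hfy fy s(1) t(1) y(1) by blast+
    obtain \<xi> where "s < \<xi>" "\<xi> < t" "2 \<le> Df \<xi> \<or> 2 \<le> Dg \<xi>"
      using two_jumps[OF ineq t(3) s(3) _ _ Df Dg] s(1) t(1) pq by auto
    then show ?thesis using s(1) t(1) by (intro bexI[of _ \<xi>]) auto
  next
    \<comment> \<open>An order-reversing semi-conjugacy reverses the configuration, so
      \<open>f\<close> and \<open>g\<close>, and likewise \<open>s\<close> and \<open>t\<close>,
      exchange roles.\<close>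
    case False
    then have am: "antimono_on {p..q} h" using h(1) by blast
    have lt: "b < a" if "h a < h b" "a \<in> {p..q}" "b \<in> {p..q}" for a b
      using that am by (meson monotone_onD not_le)
    have ineq: "\<rho> g y < t" "t < y" "y < s" "s < \<rho> f y"
      using lt hfy fy s(1) t(1) y(1) by blast+
    obtain \<xi> where "t < \<xi>" "\<xi> < s" "2 \<le> Dg \<xi> \<or> 2 \<le> Df \<xi>"
      using two_jumps[OF ineq s(3) t(3) _ _ Dg Df] s(1) t(1) pq by auto
    then show ?thesis using s(1) t(1) by (intro bexI[of _ \<xi>]) auto
  qed
qed

text \<open>A component has fixed endpoints, so each derivative equals 1 somewhere on it, while on a
  faithful one some derivative also reaches 2. Uniform continuity therefore bounds the lengths of
  faithful components from below.\<close>

lemma finite_faithful_components: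
  assumes H: "\<And>J. J \<in> components (moved \<Gamma>) \<Longrightarrow> \<not> faithful_on thompsonF \<rho> J \<or> semiconj_standard \<rho> J"
  shows "finite {J \<in> components (moved \<Gamma>). faithful_on thompsonF \<rho> J}" (is "finite ?C")
proof -
  obtain f g where fg: "f \<in> carrier thompsonF" "g \<in> carrier thompsonF"
    "f (3/4) = 3/4" "g (1/4) = 1/4" "f (1/2) < 1/4" "3/4 < g (1/2)"
    using jump_pair by metis
  obtain Df where Df: "continuous_on {0..1} Df"
    "\<And>x. x \<in> {0..1} \<Longrightarrow> (\<rho> f has_real_derivative Df x) (at x within {0..1})"
    using diff[OF fg(1)] unfolding diff1_plus_def by blast
  obtain Dg where Dg: "continuous_on {0..1} Dg"
    "\<And>x. x \<in> {0..1} \<Longrightarrow> (\<rho> g has_real_derivative Dg x) (at x within {0..1})"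
    using diff[OF fg(2)] unfolding diff1_plus_def by blast
  have "\<exists>\<delta>>0. \<forall>x\<in>{0..1}. \<forall>y\<in>{0..1}. \<bar>y - x\<bar> < \<delta> \<longrightarrow> \<bar>D y - D x\<bar> < 1" if D: "continuous_on {0..1} D" for D :: "real \<Rightarrow> real"
    using compact_uniformly_continuous[OF D compact_Icc]
    unfolding uniformly_continuous_on_def dist_real_def by (metis zero_less_one)
  then obtain \<delta>1 \<delta>2 where \<delta>1: "\<delta>1 > 0" "\<forall>x\<in>{0..1}. \<forall>y\<in>{0..1}. \<bar>y - x\<bar> < \<delta>1 \<longrightarrow> \<bar>Df y - Df x\<bar> < 1"
    and \<delta>2: "\<delta>2 > 0" "\<forall>x\<in>{0..1}. \<forall>y\<in>{0..1}. \<bar>y - x\<bar> < \<delta>2 \<longrightarrow> \<bar>Dg y - Dg x\<bar> < 1"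
    using Df(1) Dg(1) by meson
  define \<delta> where "\<delta> = min \<delta>1 \<delta>2"
  have \<delta>0: "\<delta> > 0" using \<delta>1 \<delta>2 by (simp add: \<delta>_def)
  \<comment> \<open>For counting, each faithful component receives the index of a multiple of
    \<open>\<delta> / 2\<close> inside it. The indices form a finite range, and disjoint components
    get different ones.\<close>
  have long: "\<exists>k::int. k * (\<delta> / 2) \<in> J \<and> k \<in> {0..\<lceil>2 / \<delta>\<rceil>}" if J: "J \<in> ?C" for J
  proof -
    obtain p q where pq: "p < q" "J = {p<..<q}" "p \<notin> moved \<Gamma>" "q \<notin> moved \<Gamma>" "0 \<le> p" "q \<le> 1"
      using component_interval[OF homeo_group_\<Gamma> _ moved_subset] J by auto
    have fix1: "\<rho> k p = p" "\<rho> k q = q" if "k \<in> carrier thompsonF" for k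
      using pq that by (auto simp: moved_def)
    have "semiconj_standard \<rho> {p<..<q}" using H J pq by blast
    then obtain \<xi> where \<xi>: "\<xi> \<in> {p<..<q}" "2 \<le> Df \<xi> \<or> 2 \<le> Dg \<xi>"
      using semiconj_expansion[OF pq(1,5,6,3,4) _ fg Df(2) Dg(2)] by blast
    have near1: "\<exists>\<eta>\<in>{p<..<q}. D \<eta> = 1"
      if D: "\<And>x. x \<in> {0..1} \<Longrightarrow> (\<rho> k has_real_derivative D x) (at x within {0..1})"
        and k: "k \<in> carrier thompsonF" for D k
    proof -
      obtain \<eta> where \<eta>: "p < \<eta>" "\<eta> < q" "\<rho> k q - \<rho> k p = D \<eta> * (q - p)"
        using mvt_unit_interval[OF D pq(5,1,6)] by metis
      then have "D \<eta> * (q - p) = 1 * (q - p)" using fix1[OF k] by simp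
      then have "D \<eta> = 1" using pq(1) by (simp only: mult_right_cancel)
      then show ?thesis using \<eta> by auto
    qed
    have len: "\<delta> \<le> q - p"
    proof (rule ccontr)
      assume "\<not> \<delta> \<le> q - p"
      then have small: "\<bar>\<xi> - \<eta>\<bar> < \<delta>1" "\<bar>\<xi> - \<eta>\<bar> < \<delta>2" if "\<eta> \<in> {p<..<q}" for \<eta>
        using that \<xi>(1) by (auto simp: \<delta>_def)
      obtain \<eta>1 \<eta>2 where "\<eta>1 \<in> {p<..<q}" "Df \<eta>1 = 1" "\<eta>2 \<in> {p<..<q}" "Dg \<eta>2 = 1"
        using near1[OF Df(2) fg(1)] near1[OF Dg(2) fg(2)] by blast
      then have "\<bar>Df \<xi> - 1\<bar> < 1" "\<bar>Dg \<xi> - 1\<bar> < 1"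
        using \<delta>1(2)[rule_format, of \<eta>1 \<xi>] \<delta>2(2)[rule_format, of \<eta>2 \<xi>] small \<xi>(1) pq by auto
      then show False using \<xi>(2) by auto
    qed
    \<comment> \<open>The first multiple of \<open>\<delta> / 2\<close> strictly beyond
      \<open>p\<close>; it is at most \<open>p + \<delta> / 2\<close>, hence before
      \<open>q\<close>.\<close>
    define k where "k = \<lfloor>p / (\<delta> / 2)\<rfloor> + 1"
    have k: "p / (\<delta> / 2) < k" "k \<le> p / (\<delta> / 2) + 1" unfolding k_def by linarith+
    have k1: "p < k * (\<delta> / 2)" using k(1) \<delta>0 by (simp add: pos_divide_less_eq)
    have "k * (\<delta> / 2) \<le> (p / (\<delta> / 2) + 1) * (\<delta> / 2)" using k(2) \<delta>0 by (intro mult_right_mono) auto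
    also have "\<dots> = p + \<delta> / 2" using \<delta>0 by (simp add: field_simps)
    finally have k2: "k * (\<delta> / 2) < q" using len \<delta>0 by simp
    have "0 \<le> k" using pq \<delta>0 by (simp add: k_def)
    moreover have "k \<le> 2 / \<delta>" using k2 pq(6) \<delta>0 by (simp add: field_simps)
    then have "k \<le> \<lceil>2 / \<delta>\<rceil>" by linarith
    ultimately show ?thesis using k1 k2 pq(2) by auto
  qed
  then obtain \<kappa> :: "real set \<Rightarrow> int" where \<kappa>: "\<And>J. J \<in> ?C \<Longrightarrow> \<kappa> J * (\<delta> / 2) \<in> J \<and> \<kappa> J \<in> {0..\<lceil>2 / \<delta>\<rceil>}"
    by metis
  have "inj_on \<kappa> ?C"
  proof (rule inj_onI)
    fix J J' assume J: "J \<in> ?C" "J' \<in> ?C" "\<kappa> J = \<kappa> J'"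
    then have "J \<inter> J' \<noteq> {}" using \<kappa>[of J] \<kappa>[of J'] by auto
    then show "J = J'" using J components_nonoverlap[of J "moved \<Gamma>" J'] by auto
  qed
  moreover have "\<kappa> ` ?C \<subseteq> {0..\<lceil>2 / \<delta>\<rceil>}" using \<kappa> by blast
  ultimately show ?thesis using inj_on_finite by blast
qed

end

section \<open>The copy of Thompson's group supported in the middle half of the unit
  interval\<close>

definition shrink :: "(real \<Rightarrow> real) \<Rightarrow> real \<Rightarrow> real" where
  "shrink = rescale 1 (1/4)"

lemma shrink_comp: "shrink (f \<circ> g) = shrink f \<circ> shrink g"
  by (simp add: shrink_def rescale_comp)

lemma shrink_inj: "shrink f = shrink g \<Longrightarrow> f = g"
  unfolding shrink_def by (rule rescale_inj)

lemma shrink_in_thompsonF: "f \<in> carrier thompsonF \<Longrightarrow> shrink f \<in> carrier thompsonF"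
proof -
  have "dyadic (1/4)" unfolding dyadic_def by (intro exI[of _ 1] exI[of _ 2]) simp
  then show "f \<in> carrier thompsonF \<Longrightarrow> shrink f \<in> carrier thompsonF"
    unfolding shrink_def using rescale_in_thompsonF[of f "1/4" 1] by simp
qed

lemma shrink_outside: "f \<in> carrier thompsonF \<Longrightarrow> x \<notin> {1/4..3/4} \<Longrightarrow> shrink f x = x"
  unfolding shrink_def using rescale_outside[of f x "1/4" 1] by auto

lemma shrink_id: "shrink id = id"
  by (auto simp: shrink_def rescale_def fun_eq_iff field_simps)

lemma shrink_commutator:
  assumes f: "f \<in> carrier thompsonF" and g: "g \<in> carrier thompsonF"
  shows "shrink (commutator f g) = commutator (shrink f) (shrink g)"
proof -
  have i: "shrink (inv_into UNIV k) = inv_into UNIV (shrink k)" if k: "k \<in> carrier thompsonF" for k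
  proof
    fix x
    have "shrink (inv_into UNIV k) (shrink k y) = y" for y
      using thompsonF_inverse[OF k] by (simp add: shrink_def rescale_def field_simps)
    then show "shrink (inv_into UNIV k) x = inv_into UNIV (shrink k) x"
      using thompsonF_inverse[OF shrink_in_thompsonF[OF k]] by metis
  qed
  show ?thesis using i[OF f] i[OF g] by (simp add: commutator_def shrink_comp)
qed

lemma commutator_ne_id:
  assumes f: "f \<in> carrier thompsonF" and g: "g \<in> carrier thompsonF" and ne: "f (g x) \<noteq> g (f x)"
  shows "commutator f g \<noteq> id"
proof
  assume "commutator f g = id"
  then have "f (g (inv_into UNIV f (inv_into UNIV g (g (f x))))) = g (f x)"
    by (simp add: commutator_def fun_eq_iff)
  then show False using ne thompsonF_inverse[OF f] thompsonF_inverse[OF g] by simp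
qed

lemma (in thompsonF_action) shrink_action: "thompsonF_action (\<lambda>g. \<rho> (shrink g))"
proof
  have "\<rho> (shrink (f \<circ> g)) = \<rho> (shrink f) \<circ> \<rho> (shrink g)"
    if "f \<in> carrier thompsonF" "g \<in> carrier thompsonF" for f g
    using comp shrink_in_thompsonF that by (auto simp: shrink_comp)
  then show "(\<lambda>g. \<rho> (shrink g)) \<in> hom thompsonF Diff1_plus_I"
    using diff shrink_in_thompsonF by (auto simp: hom_def Diff1_plus_I_def mult_thompsonF)
qed

text \<open>If \<open>e\<close> were fixed by the whole group, the semi-conjugacy would send it to 0
  or 1 and nearby points to values fixed by all shrunk elements. The ends of such a fibre would be
  \<open>p\<close> and \<open>q\<close>, giving an interior point the value 0 or 1.\<close>

lemma (in thompsonF_action) shrink_component_ends: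
  assumes H: "\<And>J. J \<in> components (moved \<Gamma>) \<Longrightarrow> \<not> faithful_on thompsonF \<rho> J \<or> semiconj_standard \<rho> J"
    and J': "{p<..<q} \<in> components (moved ((\<lambda>g. \<rho> (shrink g)) ` carrier thompsonF))" "p < q"
    and ends: "p \<notin> moved ((\<lambda>g. \<rho> (shrink g)) ` carrier thompsonF)"
      "q \<notin> moved ((\<lambda>g. \<rho> (shrink g)) ` carrier thompsonF)"
    and faithful: "faithful_on thompsonF (\<lambda>g. \<rho> (shrink g)) {p<..<q}"
    and e: "e \<in> {p, q}"
  shows "e \<in> moved \<Gamma>"
proof (rule ccontr)
  assume eG: "e \<notin> moved \<Gamma>"
  let ?\<Gamma>' = "(\<lambda>g. \<rho> (shrink g)) ` carrier thompsonF"
  have J'sub: "{p<..<q} \<subseteq> moved ?\<Gamma>'" using J' in_components_subset by blast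
  also have "\<dots> \<subseteq> moved \<Gamma>" using shrink_in_thompsonF by (auto simp: moved_def)
  finally have "{p<..<q} \<subseteq> moved \<Gamma>" .
  then obtain J where J: "J \<in> components (moved \<Gamma>)" "{p<..<q} \<subseteq> J"
    using exists_component_superset[of "{p<..<q}" "moved \<Gamma>"] J'(2) dense[of p q] by force
  obtain P Q where PQ: "P < Q" "J = {P<..<Q}" "P \<notin> moved \<Gamma>" "Q \<notin> moved \<Gamma>"
    using component_interval[OF homeo_group_\<Gamma> J(1) moved_subset] by metis
  have pqPQ: "P \<le> p" "q \<le> Q" using J(2) PQ(2) J'(2) by (auto simp: greaterThanLessThan_subseteq_greaterThanLessThan)
  \<comment> \<open>Otherwise commutators of shrunk elements act trivially on \<open>J\<close>,
    hence on \<open>{p<..<q}\<close>, although the shrunk action is faithful there.\<close>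
  have "faithful_on thompsonF \<rho> J"
  proof (rule ccontr)
    assume nf: "\<not> faithful_on thompsonF \<rho> J"
    obtain f g where fg: "f \<in> carrier thompsonF" "g \<in> carrier thompsonF"
       "f (1/2) < 1/4" "3/4 < g (1/2)" "f (g (1/2)) = g (1/2)" "g (f (1/2)) = f (1/2)"
      using jump_pair by metis
    have ne: "commutator f g \<noteq> id" using commutator_ne_id[OF fg(1,2), of "1/2"] fg by auto
    have "\<rho> (shrink (commutator f g)) x = x" if "x \<in> J" for x
      using nonfaithful_commutator[OF J(1) nf shrink_in_thompsonF[OF fg(1)] _ shrink_in_thompsonF[OF fg(2)] _ that]
        shrink_outside fg shrink_commutator by simp
    moreover note shrink_id
    ultimately have "restrict (\<rho> (shrink (commutator f g))) {p<..<q} = restrict (\<rho> (shrink id)) {p<..<q}"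
      using J(2) at_id by (intro restrict_ext) auto
    then have "commutator f g = id"
      using inj_onD[OF faithful[unfolded faithful_on_def] _ commutator_in_thompsonF[OF fg(1,2)] id_in_thompsonF]
      by blast
    then show False using ne by blast
  qed
  then have sc: "semiconj_standard \<rho> {P<..<Q}" using H[OF J(1)] PQ(2) by simp
  have cl: "closure {P<..<Q} = {P..Q}" using PQ by simp
  obtain h where h: "mono_on {P..Q} h \<or> antimono_on {P..Q} h" "h ` {P..Q} = {0..1}"
    "continuous_on {P..Q} h" "\<And>g x. g \<in> carrier thompsonF \<Longrightarrow> x \<in> {P..Q} \<Longrightarrow> h (\<rho> g x) = g (h x)"
    using sc unfolding semiconj_standard_def cl by blast
  have inv: "\<rho> k x \<in> {P..Q}" if "k \<in> carrier thompsonF" "x \<in> {P..Q}" for k x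
  proof -
    have "\<rho> k P = P" "\<rho> k Q = Q" using PQ that by (auto simp: moved_def)
    then show ?thesis using that strict_mono_less_eq[OF smono[OF that(1)]] by (metis atLeastAtMost_iff)
  qed
  \<comment> \<open>The fibre over 0 or 1 is invariant under the whole group, so its ends are global
    fixed points. Neither is in \<open>J\<close>, so they are \<open>P\<close> and \<open>Q\<close>,
    and monotonicity would make \<open>h\<close> constant.\<close>
  have interior: "h x \<notin> {0, 1}" if x: "x \<in> J" for x
  proof
    assume h01: "h x \<in> {0, 1}"
    define T where "T = {y \<in> {P..Q}. h y = h x}"
    have cT: "compact T" unfolding T_def using h(3) by (rule compact_level_set)
    have xT: "x \<in> T" using x PQ(2) by (auto simp: T_def)
    obtain a b where ab: "a \<in> T" "b \<in> T" "a \<le> x" "x \<le> b"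
      "\<forall>f f'. strict_mono f \<longrightarrow> (\<forall>y. f (f' y) = y) \<longrightarrow> f ` T \<subseteq> T \<longrightarrow> f' ` T \<subseteq> T \<longrightarrow> f a = a \<and> f b = b"
      using fiber_ends[OF cT xT] by blast
    have TT: "\<rho> k ` T \<subseteq> T" if "k \<in> carrier thompsonF" for k
      using h(4)[OF that] inv[OF that] thompsonF_outside[OF that, of "h x"] h01 by (auto simp: T_def)
    have "\<rho> k a = a \<and> \<rho> k b = b" if "k \<in> carrier thompsonF" for k
      using ab(5)[rule_format, OF smono[OF that] at_inverse(2)[OF that] TT[OF that] TT] thompsonF_inverse(1)[OF that] by blast
    then have "a \<notin> moved \<Gamma>" "b \<notin> moved \<Gamma>" by (auto simp: moved_def)
    then have "a \<notin> J" "b \<notin> J" using in_components_subset[OF J(1)] by auto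
    then have "a = P" "b = Q" using ab(1-4) x PQ(2) by (auto simp: T_def)
    then have hPQ: "h P = h x" "h Q = h x" using ab by (auto simp: T_def)
    have "h y = h x" if "y \<in> {P..Q}" for y
      using h(1)
    proof
      assume m: "mono_on {P..Q} h"
      have "h P \<le> h y" "h y \<le> h Q"
        using monotone_onD[OF m, of P y] monotone_onD[OF m, of y Q] that PQ(1) by simp_all
      then show ?thesis using hPQ by simp
    next
      assume m: "antimono_on {P..Q} h"
      have "h P \<ge> h y" "h y \<ge> h Q"
        using monotone_onD[OF m, of P y] monotone_onD[OF m, of y Q] that PQ(1) by simp_all
      then show ?thesis using hPQ by simp
    qed
    then have "h ` {P..Q} \<subseteq> {h x}" by blast
    moreover have "1/2 \<in> h ` {P..Q}" using h(2) by simp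
    ultimately have "1/2 = h x" by blast
    then show False using h01 by auto
  qed
  have ePQ: "e \<in> {P..Q}" using e pqPQ J'(2) by auto
  \<comment> \<open>By equivariance a fixed point has a fixed image, and Thompson's group fixes no
    point of the open unit interval.\<close>
  have he: "h e \<in> {0, 1}"
  proof (rule ccontr)
    assume "h e \<notin> {0, 1}"
    moreover have "h e \<in> {0..1}" using h(2) ePQ by blast
    ultimately have "h e \<in> {0<..<1}" by auto
    then obtain k where k: "k \<in> carrier thompsonF" "k (h e) \<noteq> h e" using thompsonF_moves by blast
    have "\<rho> k e = e" using eG k(1) by (auto simp: moved_def)
    then show False using h(4)[OF k(1) ePQ] k(2) by simp
  qed
  \<comment> \<open>The strict margin 1/4 around the value 0 or 1 keeps \<open>h\<close> out of
    \<open>{1/4..3/4}\<close> near \<open>e\<close>.\<close>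
  obtain d where d: "d > 0" "\<And>y. y \<in> {P..Q} \<Longrightarrow> \<bar>y - e\<bar> < d \<Longrightarrow> \<bar>h y - h e\<bar> < 1/4"
    using h(3) ePQ unfolding continuous_on_iff dist_real_def
    by (metis zero_less_divide_1_iff zero_less_numeral)
  obtain x where x: "x \<in> {p<..<q}" "\<bar>x - e\<bar> < d"
  proof (cases "e = p")
    case True
    show thesis using that[of "p + min d (q - p) / 2"] True d(1) J'(2) by (auto simp: min_def field_simps)
  next
    case False
    show thesis using that[of "q - min d (q - p) / 2"] False e d(1) J'(2) by (auto simp: min_def field_simps)
  qed
  have xJ: "x \<in> J" using x J by blast
  have hx: "h x \<notin> {1/4..3/4}" using d(2)[of x] x xJ PQ(2) he by auto
  \<comment> \<open>The fibre is cut down to \<open>{p..q}\<close>: shrunk elements fix the value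
    \<open>h x\<close> as well as \<open>p\<close> and \<open>q\<close>, so they preserve
    \<open>T\<close>.\<close>
  define T where "T = {y \<in> {p..q}. h y = h x}"
  have "continuous_on {p..q} h" using h(3) pqPQ continuous_on_subset by (metis atLeastatMost_subset_iff)
  then have cT: "compact T" unfolding T_def by (rule compact_level_set)
  have xT: "x \<in> T" using x by (auto simp: T_def)
  obtain a b where ab: "a \<in> T" "b \<in> T" "a \<le> x" "x \<le> b"
    "\<forall>f f'. strict_mono f \<longrightarrow> (\<forall>y. f (f' y) = y) \<longrightarrow> f ` T \<subseteq> T \<longrightarrow> f' ` T \<subseteq> T \<longrightarrow> f a = a \<and> f b = b"
    using fiber_ends[OF cT xT] by blast
  interpret S: thompsonF_action "\<lambda>g. \<rho> (shrink g)" using shrink_action .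
  have TT: "\<rho> (shrink k) ` T \<subseteq> T" if k: "k \<in> carrier thompsonF" for k
  proof
    fix z assume "z \<in> \<rho> (shrink k) ` T"
    then obtain y where y: "z = \<rho> (shrink k) y" "y \<in> {p..q}" "h y = h x" by (auto simp: T_def)
    have "\<rho> (shrink k) p = p" "\<rho> (shrink k) q = q" using ends k by (auto simp: moved_def)
    then have "z \<in> {p..q}"
      using y strict_mono_less_eq[OF S.smono[OF k]] by (metis atLeastAtMost_iff)
    moreover have "h z = shrink k (h y)"
      using y pqPQ h(4)[OF shrink_in_thompsonF[OF k], of y] by auto
    then have "h z = h x" using shrink_outside[OF k hx] y(3) by simp
    ultimately show "z \<in> T" by (simp add: T_def)
  qed
  have "\<rho> (shrink k) a = a \<and> \<rho> (shrink k) b = b" if "k \<in> carrier thompsonF" for k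
    using ab(5)[rule_format, OF S.smono[OF that] S.at_inverse(2)[OF that] TT[OF that] TT] thompsonF_inverse(1)[OF that] by blast
  then have "a \<notin> moved ?\<Gamma>'" "b \<notin> moved ?\<Gamma>'" by (auto simp: moved_def)
  then have "a \<notin> {p<..<q}" "b \<notin> {p<..<q}" using J'sub by blast+
  then have "a = p" "b = q" using ab(1-4) x by (auto simp: T_def)
  then have "h e = h x" using ab e by (auto simp: T_def)
  then show False using interior[OF xJ] he by simp
qed

section \<open>The free product of Thompson's group and the integers\<close>

definition embed_F :: "(real \<Rightarrow> real) \<Rightarrow> ((real \<Rightarrow> real) + int) list" where
  "embed_F g = (if g = id then [] else [Inl g])"

lemma embed_F_hom: "embed_F \<in> hom thompsonF (free_product thompsonF integer_group)"
  by (auto simp: hom_def embed_F_def free_product_def fp_reduced_Cons one_thompsonF mult_thompsonF)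

lemma embed_F_inj: "inj embed_F"
  by (auto simp: inj_on_def embed_F_def split: if_splits)

lemma shrink_hom: "shrink \<in> hom thompsonF thompsonF"
  by (auto simp: hom_def mult_thompsonF shrink_comp shrink_in_thompsonF)

theorem theorem1p4:
  fixes \<phi> :: "((real \<Rightarrow> real) + int) list \<Rightarrow> real \<Rightarrow> real"
  assumes hom: "\<phi> \<in> hom (free_product thompsonF integer_group) Diff1_plus_I"
    and H: "\<And>\<iota> J. \<iota> \<in> hom thompsonF (free_product thompsonF integer_group) \<Longrightarrow>
               inj_on \<iota> (carrier thompsonF) \<Longrightarrow>
               J \<in> components (supp_action thompsonF (\<lambda>g. \<phi> (\<iota> g))) \<Longrightarrow>
               \<not> faithful_on thompsonF (\<lambda>g. \<phi> (\<iota> g)) J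
               \<or> semiconj_standard (\<lambda>g. \<phi> (\<iota> g)) J"
  shows "\<not> inj_on \<phi> (carrier (free_product thompsonF integer_group))"
proof
  assume inj: "inj_on \<phi> (carrier (free_product thompsonF integer_group))"
  have car: "carrier (free_product thompsonF integer_group) = {w. fp_reduced thompsonF integer_group w}"
    by (simp add: free_product_def)
  have d: "diff1_plus (\<phi> w)" if "fp_reduced thompsonF integer_group w" for w
    using hom that car by (auto simp: hom_def Diff1_plus_I_def)
  interpret W: word_action thompsonF integer_group \<phi>
  proof (rule word_action.intro)
    show "\<phi> (foldr (fp_push thompsonF integer_group) x y) = \<phi> x \<circ> \<phi> y"
      if "fp_reduced thompsonF integer_group x" "fp_reduced thompsonF integer_group y" for x y
      using hom that by (auto simp: hom_def Diff1_plus_I_def free_product_def)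
  qed (use group_thompsonF group_integer_group d diff1_plus_strict_mono diff1_plus_outside in blast)+
  \<comment> \<open>\<open>\<rho>\<close> is the action of the free factor and
    \<open>\<rho>'\<close> that of its shrunk copy. The hypothesis on embeddings is used for both,
    under the interpretations \<open>A\<close> and \<open>B\<close>.\<close>
  define \<rho> where "\<rho> g = \<phi> (embed_F g)" for g
  define \<rho>' where "\<rho>' g = \<rho> (shrink g)" for g
  have hom\<rho>: "\<rho> \<in> hom thompsonF Diff1_plus_I"
    using Group.hom_compose[OF embed_F_hom hom] by (simp add: \<rho>_def[abs_def] comp_def)
  interpret A: thompsonF_action \<rho> using hom\<rho> by unfold_locales
  interpret B: thompsonF_action \<rho>' using A.shrink_action by (simp add: \<rho>'_def[abs_def])
  have HA: "\<not> faithful_on thompsonF \<rho> J \<or> semiconj_standard \<rho> J" if "J \<in> components (moved A.\<Gamma>)" for J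
    using H[OF embed_F_hom inj_on_subset[OF embed_F_inj subset_UNIV]] that A.supp_action_eq
    by (simp add: \<rho>_def[abs_def])
  have HB: "\<not> faithful_on thompsonF \<rho>' J \<or> semiconj_standard \<rho>' J" if J: "J \<in> components (moved B.\<Gamma>)" for J
  proof -
    have "embed_F \<circ> shrink \<in> hom thompsonF (free_product thompsonF integer_group)"
      using Group.hom_compose[OF shrink_hom embed_F_hom] .
    moreover have "inj_on (embed_F \<circ> shrink) (carrier thompsonF)"
      using embed_F_inj shrink_inj by (auto simp: inj_on_def)
    ultimately show ?thesis
      using H[of "embed_F \<circ> shrink" J] J B.supp_action_eq by (simp add: \<rho>'_def[abs_def] \<rho>_def[abs_def])
  qed
  define \<C> where "\<C> = {J \<in> components (moved B.\<Gamma>). faithful_on thompsonF \<rho>' J}"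
  have fin: "finite \<C>" unfolding \<C>_def using B.finite_faithful_components HB by blast
  have "\<rho> g \<in> W.\<Gamma>" if "g \<in> carrier thompsonF" for g
    using that embed_F_hom W.\<phi>_in by (auto simp: \<rho>_def hom_def free_product_def)
  then have AW: "moved A.\<Gamma> \<subseteq> moved W.\<Gamma>" by (auto simp: moved_def)
  have BA: "moved B.\<Gamma> \<subseteq> moved A.\<Gamma>" using shrink_in_thompsonF by (auto simp: moved_def \<rho>'_def)
  \<comment> \<open>The endpoints of a faithful component of \<open>B\<close> are moved by
    \<open>A\<close>, so its closure lies in one component of the set moved by the whole free
    product. This turns its endpoints into bounds inside that component.\<close>
  have "\<exists>p q J. p \<in> J \<and> q \<in> J \<and> C = {p<..<q} \<and> J \<in> components (moved W.\<Gamma>)" if C: "C \<in> \<C>" for C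
  proof -
    have CB: "C \<in> components (moved B.\<Gamma>)" "faithful_on thompsonF \<rho>' C" using C by (auto simp: \<C>_def)
    obtain p q where pq: "p < q" "C = {p<..<q}" "p \<notin> moved B.\<Gamma>" "q \<notin> moved B.\<Gamma>"
      using component_interval[OF B.homeo_group_\<Gamma> CB(1) B.moved_subset] by metis
    have "e \<in> moved A.\<Gamma>" if "e \<in> {p, q}" for e
      by (rule A.shrink_component_ends[OF HA _ pq(1)])
         (use CB pq that in \<open>simp_all add: \<rho>'_def[abs_def]\<close>)
    then have "p \<in> moved W.\<Gamma>" "q \<in> moved W.\<Gamma>" using AW by auto
    moreover have "{p<..<q} \<subseteq> moved W.\<Gamma>" using CB(1) pq(2) in_components_subset BA AW by blast
    ultimately have sub: "{p..q} \<subseteq> moved W.\<Gamma>" by (auto simp: less_le subset_iff)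
    have "moved W.\<Gamma> \<noteq> {}" using sub pq(1) by auto
    with sub obtain J where J: "J \<in> components (moved W.\<Gamma>)" "{p..q} \<subseteq> J"
      using exists_component_superset[of "{p..q}" "moved W.\<Gamma>"] connected_Icc by metis
    have "p \<in> J" "q \<in> J" using J(2) pq(1) by auto
    then show ?thesis using pq(2) J(1) by blast
  qed
  then obtain lo hi :: "real set \<Rightarrow> real" and cc where
    cc: "\<And>C. C \<in> \<C> \<Longrightarrow> lo C \<in> cc C \<and> hi C \<in> cc C \<and> C = {lo C<..<hi C} \<and> cc C \<in> components (moved W.\<Gamma>)"
    by metis
  have Ccc: "C \<subseteq> cc C" if C: "C \<in> \<C>" for C
  proof -
    obtain p q where "cc C = {p<..<q}"
      using component_interval[OF W.homeo_group_\<Gamma> _ W.moved_\<Gamma>_subset] cc[OF C] by metis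
    then show ?thesis using cc[OF C] by (metis greaterThanLessThan_iff greaterThanLessThan_subseteq_greaterThanLessThan less_imp_le)
  qed
  obtain f g where fg: "f \<in> carrier thompsonF" "g \<in> carrier thompsonF"
     "f (1/2) < 1/4" "3/4 < g (1/2)" "f (g (1/2)) = g (1/2)" "g (f (1/2)) = f (1/2)"
    using jump_pair by metis
  \<comment> \<open>As a commutator of shrunk elements, \<open>v\<close> acts trivially through
    \<open>\<rho>'\<close> on every non-faithful component. Since \<open>\<rho>'\<close> shrinks
    once more, the letter used is \<open>shrink v\<close>.\<close>
  define v where "v = commutator (shrink f) (shrink g)"
  have vF: "v \<in> carrier thompsonF" using fg shrink_in_thompsonF commutator_in_thompsonF by (simp add: v_def)
  have "commutator f g \<noteq> id" using commutator_ne_id[OF fg(1,2), of "1/2"] fg by auto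
  then have "shrink v \<noteq> id"
    using shrink_inj shrink_id shrink_commutator[OF fg(1,2)] unfolding v_def by metis
  then have u: "embed_F (shrink v) = [Inl (shrink v)]" by (simp add: embed_F_def)
  have ur: "fp_reduced thompsonF integer_group [Inl (shrink v)]"
    using vF shrink_in_thompsonF \<open>shrink v \<noteq> id\<close> by (simp add: fp_reduced_Cons one_thompsonF)
  have \<phi>u: "\<phi> [Inl (shrink v)] = \<rho>' v" by (simp add: \<rho>'_def \<rho>_def u)
  have supp: "\<exists>C\<in>\<C>. x \<in> C" if x: "\<phi> [Inl (shrink v)] x \<noteq> x" for x
  proof -
    have "x \<in> moved B.\<Gamma>" using x vF by (auto simp: \<phi>u moved_def)
    then obtain C where C: "C \<in> components (moved B.\<Gamma>)" "x \<in> C" using Union_components[of "moved B.\<Gamma>"] by blast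
    have "faithful_on thompsonF \<rho>' C"
    proof (rule ccontr)
      assume nf: "\<not> faithful_on thompsonF \<rho>' C"
      have "\<rho>' v x = x" unfolding v_def
        by (rule B.nonfaithful_commutator[OF C(1) nf])
           (use fg shrink_in_thompsonF shrink_outside C in auto)
      then show False using x \<phi>u by simp
    qed
    then show ?thesis using C by (auto simp: \<C>_def)
  qed
  show False
  \<comment> \<open>The jump pair supplies two distinct nontrivial letters, and the integer 1 a
    nontrivial letter of the other factor, whose identity is 0.\<close>
  proof (rule W.no_compactly_supported_word[where a = f and b = g and t = 1 and \<J> = "cc ` \<C>" and u = "[Inl (shrink v)]"])
    show "f \<noteq> \<one>\<^bsub>thompsonF\<^esub>" "g \<noteq> \<one>\<^bsub>thompsonF\<^esub>" "f \<noteq> g" using fg by (auto simp: one_thompsonF)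
    show "inj_on \<phi> {w. fp_reduced thompsonF integer_group w}" using inj car by simp
    show "cc ` \<C> \<subseteq> components (moved W.\<Gamma>)" using cc by blast
    show "x \<in> \<Union> (cc ` \<C>)" if "\<phi> [Inl (shrink v)] x \<noteq> x" for x using supp[OF that] Ccc by blast
    show "\<exists>c\<in>J. \<exists>d\<in>J. \<forall>x\<in>J. \<phi> [Inl (shrink v)] x \<noteq> x \<longrightarrow> c \<le> x \<and> x \<le> d" if J: "J \<in> cc ` \<C>" for J
    proof -
      \<comment> \<open>Several faithful components of the copy may lie in the same
        \<open>J\<close>; as there are finitely many, extremal endpoints bound the support.\<close>
      define D where "D = {C \<in> \<C>. cc C = J}"
      have D: "finite D" "D \<noteq> {}" using fin J by (auto simp: D_def)
      have "lo ` D \<subseteq> J" "hi ` D \<subseteq> J" using cc by (auto simp: D_def)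
      moreover have "Min (lo ` D) \<in> lo ` D" "Max (hi ` D) \<in> hi ` D"
        using D by (auto intro!: Min_in Max_in simp del: Min_in Max_in)
      ultimately have in_J: "Min (lo ` D) \<in> J" "Max (hi ` D) \<in> J" by blast+
      have "Min (lo ` D) \<le> x \<and> x \<le> Max (hi ` D)" if x: "x \<in> J" "\<phi> [Inl (shrink v)] x \<noteq> x" for x
      proof -
        obtain C where C: "C \<in> \<C>" "x \<in> C" using supp x(2) by blast
        then have "cc C \<inter> J \<noteq> {}" using Ccc x(1) by blast
        then have "cc C = J" using components_nonoverlap[of "cc C" "moved W.\<Gamma>" J] cc C J by auto
        then have CD: "C \<in> D" using C by (simp add: D_def)
        have "Min (lo ` D) \<le> lo C" "hi C \<le> Max (hi ` D)" using CD D by auto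
        moreover have "lo C < x" "x < hi C" using cc[OF C(1)] C(2) by auto
        ultimately show ?thesis by linarith
      qed
      then show ?thesis using in_J by blast
    qed
  qed (use fg ur fin in auto)
qed

end
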